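(* Let $G$ be an unmixed chordal graph on $n$ vertices such that the independence complex $\mathrm{Ind}(G)$ of $G$ has dimension $1$. Then $$b_1(J(G)) = 2b_0(J(G))-n \qquad\text{and}\qquad b_2(J(G)) = b_0(J(G))-n+1.$$
   Context: All graphs are finite and simple. A graph is chordal if it has no induced cycle of length greater than $3$. A graph is unmixed if all of its minimal vertex covers have the same cardinality. The independence complex $\mathrm{Ind}(G)$ is the simplicial complex on $V(G)$ whose facets are the maximal independent sets of $G$; the dimension of a face $F$ is $|F|-1$, and the dimension of a complex is the maximum dimension of its faces. The vertices of a graph are identified with the variables of a polynomial ring $S=\Bbbk[x_1,\dots,x_n]$ over a field $\Bbbk$. A vertex cover is a set of vertices meeting every edge; it is minimal if no proper subset is a vertex cover; the only minimal vertex cover of a graph with no edges is $\emptyset$. The cover ideal $J(G)$ is the ideal generated by the monomials $\prod_{x\in C}x$ with $C$ a minimal vertex cover of $G$ (so $J(G)=(1)$ if $G$ has no edges, with $b_0(J(G))=1$ and $b_p(J(G))=0$ for $p\ne 0$). $b_i(I)$ denotes the $i$-th total Betti number of the ideal $I$ itself (not of $S/I$). *)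

theory Defs
  imports
    "HOL-Library.Poly_Mapping"
    "Jordan_Normal_Form.Matrix_Kernel"
begin

section \<open>Graphs\<close>

text \<open>
  A graph is given by its set of edges; its vertex set is the whole (finite) type of vertices, so
  isolated vertices are allowed.
\<close>

definition simple_graph :: "'v set set \<Rightarrow> bool" where
  "simple_graph E \<longleftrightarrow> (\<forall>e\<in>E. card e = 2)"

definition induced_cycle :: "'v set set \<Rightarrow> 'v list \<Rightarrow> bool" where
  "induced_cycle E vs \<longleftrightarrow> distinct vs \<and> length vs \<ge> 3 \<and>
     (\<forall>i<length vs. \<forall>j<length vs.
        {vs ! i, vs ! j} \<in> E \<longleftrightarrow> j = Suc i mod length vs \<or> i = Suc j mod length vs)"

definition chordal :: "'v set set \<Rightarrow> bool" where
  "chordal E \<longleftrightarrow> \<not> (\<exists>vs. induced_cycle E vs \<and> length vs > 3)"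

definition vertex_cover :: "'v set set \<Rightarrow> 'v set \<Rightarrow> bool" where
  "vertex_cover E C \<longleftrightarrow> (\<forall>e\<in>E. e \<inter> C \<noteq> {})"

definition minimal_vertex_cover :: "'v set set \<Rightarrow> 'v set \<Rightarrow> bool" where
  "minimal_vertex_cover E C \<longleftrightarrow> vertex_cover E C \<and> (\<forall>D. D \<subset> C \<longrightarrow> \<not> vertex_cover E D)"

definition unmixed :: "'v set set \<Rightarrow> bool" where
  "unmixed E \<longleftrightarrow>
     (\<forall>C D. minimal_vertex_cover E C \<longrightarrow> minimal_vertex_cover E D \<longrightarrow> card C = card D)"

definition independent :: "'v set set \<Rightarrow> 'v set \<Rightarrow> bool" where
  "independent E A \<longleftrightarrow> (\<forall>e\<in>E. \<not> e \<subseteq> A)"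

definition maximal_independent :: "'v set set \<Rightarrow> 'v set \<Rightarrow> bool" where
  "maximal_independent E A \<longleftrightarrow> independent E A \<and> (\<forall>B. A \<subset> B \<longrightarrow> \<not> independent E B)"

text \<open>A simplicial complex is represented by the set of all its faces, the empty face included.\<close>

definition independence_complex :: "'v set set \<Rightarrow> 'v set set" where
  "independence_complex E = {F. \<exists>M. maximal_independent E M \<and> F \<subseteq> M}"

definition complex_dim :: "'v set set \<Rightarrow> int" where
  "complex_dim \<Delta> = Max ((\<lambda>F. int (card F) - 1) ` \<Delta>)"


section \<open>The polynomial ring and cover ideals\<close>

text \<open>
  Monomials are exponent vectors \<open>'v \<Rightarrow>\<^sub>0 nat\<close>; multiplication on the type below is convolution,
  so this is the polynomial ring over \<open>'k\<close> with one variable for each element of \<open>'v\<close>.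
\<close>

type_synonym ('v, 'k) poly_ring = "('v \<Rightarrow>\<^sub>0 nat) \<Rightarrow>\<^sub>0 'k"

definition Var :: "'v \<Rightarrow> ('v, 'k::comm_ring_1) poly_ring" where
  "Var v = Poly_Mapping.single (Poly_Mapping.single v 1) 1"

definition ideal_gen :: "'r::comm_ring_1 set \<Rightarrow> 'r set" where
  "ideal_gen = Modules.module.span (*)"

definition cover_ideal :: "'v::finite set set \<Rightarrow> ('v, 'k::field) poly_ring set" where
  "cover_ideal E = ideal_gen {(\<Prod>v\<in>C. Var v) | C. minimal_vertex_cover E C}"


section \<open>Minimal graded free resolutions and Betti numbers\<close>

definition monomial_degree :: "('v \<Rightarrow>\<^sub>0 nat) \<Rightarrow> nat" where
  "monomial_degree m = (\<Sum>v\<in>Poly_Mapping.keys m. Poly_Mapping.lookup m v)"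

text \<open>The zero polynomial is homogeneous of every degree, and is the only one of negative degree.\<close>

definition homogeneous :: "int \<Rightarrow> ('v, 'k::comm_ring_1) poly_ring \<Rightarrow> bool" where
  "homogeneous a p \<longleftrightarrow> (\<forall>m\<in>Poly_Mapping.keys p. int (monomial_degree m) = a)"

definition irrelevant_ideal :: "('v, 'k::comm_ring_1) poly_ring set" where
  "irrelevant_ideal = ideal_gen (range Var)"

definition mat_image :: "'r::comm_ring_1 mat \<Rightarrow> 'r vec set" where
  "mat_image A = (\<lambda>w. A *\<^sub>v w) ` carrier_vec (dim_col A)"

text \<open>
  A free resolution \<open>\<dots> \<rightarrow> S^(r 1) \<rightarrow> S^(r 0) \<rightarrow> I \<rightarrow> 0\<close> of an ideal \<open>I\<close> of \<open>S\<close>.  The matrix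
  \<open>d (Suc i)\<close> is the differential from homological degree \<open>i + 1\<close> to \<open>i\<close>, while \<open>d 0\<close> is the row
  matrix of the augmentation onto \<open>I \<subseteq> S\<close>.
\<close>

definition free_resolution :: "'r::comm_ring_1 set \<Rightarrow> (nat \<Rightarrow> nat) \<Rightarrow> (nat \<Rightarrow> 'r mat) \<Rightarrow> bool" where
  "free_resolution I r d \<longleftrightarrow>
     d 0 \<in> carrier_mat 1 (r 0) \<and>
     (\<forall>i. d (Suc i) \<in> carrier_mat (r i) (r (Suc i))) \<and>
     mat_image (d 0) = (\<lambda>p. vec 1 (\<lambda>_. p)) ` I \<and>
     (\<forall>i. mat_kernel (d i) = mat_image (d (Suc i)))"

text \<open>
  The \<open>j\<close>-th basis element in homological degree \<open>i\<close> has internal degree \<open>s i j\<close>; all maps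
  preserve degrees.
\<close>

definition graded_free_resolution ::
    "('v, 'k::comm_ring_1) poly_ring set \<Rightarrow> (nat \<Rightarrow> nat) \<Rightarrow> (nat \<Rightarrow> nat \<Rightarrow> int) \<Rightarrow>
     (nat \<Rightarrow> ('v, 'k) poly_ring mat) \<Rightarrow> bool" where
  "graded_free_resolution I r s d \<longleftrightarrow>
     free_resolution I r d \<and>
     (\<forall>b<r 0. homogeneous (s 0 b) (d 0 $$ (0, b))) \<and>
     (\<forall>i. \<forall>a<r i. \<forall>b<r (Suc i). homogeneous (s (Suc i) b - s i a) (d (Suc i) $$ (a, b)))"

text \<open>The augmentation \<open>d 0\<close> is exempt from the minimality condition.\<close>

definition minimal_graded_free_resolution ::
    "('v, 'k::comm_ring_1) poly_ring set \<Rightarrow> (nat \<Rightarrow> nat) \<Rightarrow> (nat \<Rightarrow> nat \<Rightarrow> int) \<Rightarrow>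
     (nat \<Rightarrow> ('v, 'k) poly_ring mat) \<Rightarrow> bool" where
  "minimal_graded_free_resolution I r s d \<longleftrightarrow>
     graded_free_resolution I r s d \<and>
     (\<forall>i. \<forall>a<r i. \<forall>b<r (Suc i). d (Suc i) $$ (a, b) \<in> irrelevant_ideal)"

text \<open>Total Betti numbers of the ideal \<open>I\<close> itself, not of the quotient by \<open>I\<close>.\<close>

definition betti :: "nat \<Rightarrow> ('v, 'k::field) poly_ring set \<Rightarrow> nat" where
  "betti i I = (THE b. \<exists>r s d. minimal_graded_free_resolution I r s d \<and> r i = b)"

end

theory Submission
  imports Defs
begin

text \<open>
  The complement of \<open>G\<close> is bipartite with parts \<open>A\<close>, \<open>B\<close> and contains vertices \<open>a\<^sub>0 \<in> A\<close>, \<open>b\<^sub>0 \<in> B\<close>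
  joined to the whole opposite part.  Its edges \<open>ab\<close> index the generators \<open>e(a, b)\<close> of \<open>J(G)\<close>, and
  the relations are spanned by \<open>x(b) e(a, b) - x(b\<^sub>0) e(a, b\<^sub>0)\<close> for \<open>b \<noteq> b\<^sub>0\<close> and
  \<open>x(a) e(a, b) - x(a\<^sub>0) e(a\<^sub>0, b)\<close> for \<open>a \<noteq> a\<^sub>0\<close>.  The two families commute, which gives one second
  syzygy for each edge avoiding both \<open>a\<^sub>0\<close> and \<open>b\<^sub>0\<close>, and there is nothing further.  With \<open>e\<close> edges
  the ranks are \<open>e\<close>, \<open>(e - |A|) + (e - |B|)\<close> and \<open>e - |A| - |B| + 1\<close>.  Ranks of minimal resolutions
  are unique because comparison maps become mutually inverse over the field after passing to
  constant terms.
\<close>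

section \<open>Uniqueness of ranks in minimal free resolutions\<close>

text \<open>If \<open>m < n\<close>, padding both factors with zeros to square matrices leaves the
  product unchanged, and a one-sided inverse of a square matrix over a field is two-sided. But row
  \<open>m\<close> of \<open>Q'\<close> is zero, so \<open>Q' * P'\<close> is not the
  identity.\<close>

lemma mat_mult_one_dim_le:
  fixes P Q :: "'a::field mat"
  assumes P: "P \<in> carrier_mat n m" and Q: "Q \<in> carrier_mat m n" and PQ: "P * Q = 1\<^sub>m n"
  shows "n \<le> m"
proof (rule ccontr)
  assume "\<not> n \<le> m"
  hence mn: "m < n" by simp
  define P' where "P' = mat n n (\<lambda>(i, j). if j < m then P $$ (i, j) else 0)"
  define Q' where "Q' = mat n n (\<lambda>(i, j). if i < m then Q $$ (i, j) else 0)"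
  have c: "P' \<in> carrier_mat n n" "Q' \<in> carrier_mat n n" by (auto simp: P'_def Q'_def)
  have "P' * Q' = P * Q"
  proof (rule eq_matI)
    fix i j assume "i < dim_row (P * Q)" "j < dim_col (P * Q)"
    hence ij: "i < n" "j < n" using P Q by auto
    have "(P' * Q') $$ (i, j) = (\<Sum>k<n. P' $$ (i, k) * Q' $$ (k, j))"
      using ij c by (auto simp: scalar_prod_def lessThan_atLeast0 intro!: sum.cong)
    also have "\<dots> = (\<Sum>k<m. P' $$ (i, k) * Q' $$ (k, j))"
      using mn ij by (intro sum.mono_neutral_right) (auto simp: P'_def)
    also have "\<dots> = (\<Sum>k<m. P $$ (i, k) * Q $$ (k, j))"
      using mn ij by (intro sum.cong) (auto simp: P'_def Q'_def)
    also have "\<dots> = (P * Q) $$ (i, j)"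
      using ij P Q by (auto simp: scalar_prod_def lessThan_atLeast0 intro!: sum.cong)
    finally show "(P' * Q') $$ (i, j) = (P * Q) $$ (i, j)" .
  qed (use P Q c in auto)
  hence QP: "Q' * P' = 1\<^sub>m n" using mat_mult_left_right_inverse[OF c] PQ by simp
  have "(Q' * P') $$ (m, m) = 0"
    using mn c by (auto simp: scalar_prod_def Q'_def P'_def)
  with QP mn show False by simp
qed

section \<open>Chain maps and homotopies between free resolutions\<close>

lemma free_resolution_carrier:
  assumes "free_resolution I r d"
  shows "d 0 \<in> carrier_mat 1 (r 0)" "d (Suc i) \<in> carrier_mat (r i) (r (Suc i))"
  using assms by (auto simp: free_resolution_def)

text \<open>Projectivity of a free module in matrix form: chosen preimages of the columns of
  \<open>N\<close> under \<open>D\<close> become the columns of \<open>M\<close>.\<close>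

lemma mat_factor_through:
  fixes D N :: "'r::comm_ring_1 mat"
  assumes D: "D \<in> carrier_mat nr nc" and N: "N \<in> carrier_mat nr k"
    and img: "\<And>j. j < k \<Longrightarrow> col N j \<in> mat_image D"
  shows "\<exists>M \<in> carrier_mat nc k. N = D * M"
proof -
  have "\<exists>w. w \<in> carrier_vec nc \<and> col N j = D *\<^sub>v w" if "j < k" for j
    using img[OF that] D by (auto simp: mat_image_def)
  then obtain w where w: "\<And>j. j < k \<Longrightarrow> w j \<in> carrier_vec nc \<and> col N j = D *\<^sub>v w j" by metis
  define M where "M = mat_of_cols nc (map w [0..<k])"
  have M: "M \<in> carrier_mat nc k" using mat_of_cols_carrier(1)[of nc "map w [0..<k]"] by (simp add: M_def)
  have "N = D * M"
  proof (rule mat_col_eqI)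
    fix j assume "j < dim_col (D * M)"
    hence j: "j < k" using M by simp
    have "col M j = w j" using j w by (simp add: M_def)
    thus "col N j = col (D * M) j" using col_mult2[OF D M j] w[OF j] by simp
  qed (use D N M in auto)
  thus ?thesis using M by blast
qed

lemma col_in_mat_image:
  assumes A: "A \<in> carrier_mat nr nc" and j: "j < nc"
  shows "col A j \<in> mat_image A"
proof -
  have "col A j = A *\<^sub>v unit_vec nc j"
    using col_mult2[OF A one_carrier_mat j] A j by simp
  thus ?thesis using A by (auto simp: mat_image_def)
qed

text \<open>The columns of \<open>N\<close> lie in the kernel of \<open>d i\<close>, hence by
  exactness in the image of \<open>d (Suc i)\<close>, and a choice of preimages gives
  \<open>M\<close>.\<close>

lemma free_resolution_lift:
  fixes d :: "nat \<Rightarrow> 'r::comm_ring_1 mat"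
  assumes res: "free_resolution I r d" and N: "N \<in> carrier_mat (r i) k"
    and z: "d i * N = 0\<^sub>m (dim_row (d i)) k"
  shows "\<exists>M \<in> carrier_mat (r (Suc i)) k. N = d (Suc i) * M"
proof (rule mat_factor_through[OF free_resolution_carrier(2)[OF res] N])
  fix j assume j: "j < k"
  have di: "d i \<in> carrier_mat (dim_row (d i)) (r i)"
    using free_resolution_carrier[OF res] by (cases i) auto
  have "d i *\<^sub>v col N j = col (d i * N) j" by (rule col_mult2[OF di N j, symmetric])
  also have "\<dots> = 0\<^sub>v (dim_row (d i))" using z j by simp
  finally have "d i *\<^sub>v col N j = 0\<^sub>v (dim_row (d i))" .
  moreover have "col N j \<in> carrier_vec (r i)" using N j by auto
  ultimately have "col N j \<in> mat_kernel (d i)" by (intro mat_kernelI[OF di])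
  thus "col N j \<in> mat_image (d (Suc i))" using res by (simp add: free_resolution_def)
qed

lemma free_resolution_lift_augmentation:
  fixes d :: "nat \<Rightarrow> 'r::comm_ring_1 mat"
  assumes res: "free_resolution I r d" and res': "free_resolution I r' d'"
  shows "\<exists>M \<in> carrier_mat (r' 0) (r 0). d 0 = d' 0 * M"
proof (rule mat_factor_through[OF free_resolution_carrier(1)[OF res'] free_resolution_carrier(1)[OF res]])
  fix j assume j: "j < r 0"
  have d0: "d 0 \<in> carrier_mat 1 (r 0)" by (rule free_resolution_carrier(1)[OF res])
  have "col (d 0) j \<in> mat_image (d 0)" using d0 j by (rule col_in_mat_image)
  thus "col (d 0) j \<in> mat_image (d' 0)" using res res' by (simp add: free_resolution_def)
qed

lemma free_resolution_comp:
  fixes d :: "nat \<Rightarrow> 'r::comm_ring_1 mat"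
  assumes res: "free_resolution I r d"
  shows "d i * d (Suc i) = 0\<^sub>m (dim_row (d i)) (r (Suc i))"
proof (rule mat_col_eqI)
  have di: "d i \<in> carrier_mat (dim_row (d i)) (r i)" and dS: "d (Suc i) \<in> carrier_mat (r i) (r (Suc i))"
    using free_resolution_carrier[OF res] by (cases i; auto)+
  show "dim_row (d i * d (Suc i)) = dim_row (0\<^sub>m (dim_row (d i)) (r (Suc i)))"
    "dim_col (d i * d (Suc i)) = dim_col (0\<^sub>m (dim_row (d i)) (r (Suc i)))" using dS by auto
  fix j assume "j < dim_col (0\<^sub>m (dim_row (d i)) (r (Suc i)))"
  hence j: "j < r (Suc i)" by simp
  have "col (d (Suc i)) j \<in> mat_image (d (Suc i))" using dS j by (rule col_in_mat_image)
  hence "col (d (Suc i)) j \<in> mat_kernel (d i)" using res by (simp add: free_resolution_def)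
  from mat_kernelD(2)[OF di this]
  show "col (d i * d (Suc i)) j = col (0\<^sub>m (dim_row (d i)) (r (Suc i))) j"
    using col_mult2[OF di dS j] j by simp
qed

text \<open>The identity of \<open>I\<close> lifts to a chain map, built degree by degree: each new
  component is a lift through the exact complex \<open>d'\<close>.\<close>

lemma free_resolution_comparison:
  fixes d :: "nat \<Rightarrow> 'r::comm_ring_1 mat"
  assumes res: "free_resolution I r d" and res': "free_resolution I r' d'"
  shows "\<exists>\<alpha>. (\<forall>i. \<alpha> i \<in> carrier_mat (r' i) (r i)) \<and> d' 0 * \<alpha> 0 = d 0 \<and>
    (\<forall>i. d' (Suc i) * \<alpha> (Suc i) = \<alpha> i * d (Suc i))"
proof -
  \<comment> \<open>The last clause is the invariant of the recursion: \<open>M * d (Suc i)\<close>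
    maps into the cycles of \<open>d'\<close>, which is exactly what the next lift requires.\<close>
  define P where "P i M \<longleftrightarrow> M \<in> carrier_mat (r' i) (r i) \<and> (i = 0 \<longrightarrow> d' 0 * M = d 0) \<and>
    d' i * (M * d (Suc i)) = 0\<^sub>m (dim_row (d' i)) (r (Suc i))" for i M
  note c = free_resolution_carrier[OF res] and c' = free_resolution_carrier[OF res']
  note z = free_resolution_comp[OF res] and z' = free_resolution_comp[OF res']
  have "\<exists>\<alpha>. \<forall>i. P i (\<alpha> i) \<and> d' (Suc i) * \<alpha> (Suc i) = \<alpha> i * d (Suc i)"
  proof (rule dependent_nat_choice)
    obtain M where M: "M \<in> carrier_mat (r' 0) (r 0)" "d 0 = d' 0 * M"
      using free_resolution_lift_augmentation[OF res res'] by blast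
    have "d' 0 * (M * d 1) = d 0 * d 1"
      using M assoc_mult_mat[OF c'(1) M(1), of "d 1" "r 1"] c(2)[of 0] by simp
    thus "\<exists>M. P 0 M" using M z[of 0] c(1) c'(1) unfolding P_def by auto
  next
    fix M i assume M: "P i M"
    have N: "M * d (Suc i) \<in> carrier_mat (r' i) (r (Suc i))" using M c(2) by (auto simp: P_def)
    from M have "d' i * (M * d (Suc i)) = 0\<^sub>m (dim_row (d' i)) (r (Suc i))" by (auto simp: P_def)
    from free_resolution_lift[OF res' N this]
    obtain L where L: "L \<in> carrier_mat (r' (Suc i)) (r (Suc i))" "M * d (Suc i) = d' (Suc i) * L" by blast
    have Mc: "M \<in> carrier_mat (r' i) (r i)" using M by (simp add: P_def)
    have "d' (Suc i) * (L * d (Suc (Suc i))) = d' (Suc i) * L * d (Suc (Suc i))"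
      by (rule assoc_mult_mat[symmetric, OF c'(2) L(1) c(2)])
    also have "\<dots> = M * (d (Suc i) * d (Suc (Suc i)))"
      unfolding L(2)[symmetric] by (rule assoc_mult_mat[OF Mc c(2) c(2)])
    also have "\<dots> = 0\<^sub>m (r' i) (r (Suc (Suc i)))"
      using z[of "Suc i"] c(2)[of i] Mc by auto
    finally show "\<exists>L. P (Suc i) L \<and> d' (Suc i) * L = M * d (Suc i)"
      using L c'(2)[of i] by (auto simp: P_def)
  qed
  thus ?thesis unfolding P_def by blast
qed

text \<open>A chain endomorphism that induces zero on \<open>I\<close> is null-homotopic. The part
  of \<open>\<gamma> (Suc i)\<close> not yet accounted for by \<open>h i\<close> consists of cycles,
  so it lifts to the next component of \<open>h\<close>.\<close>

lemma free_resolution_homotopy: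
  fixes d :: "nat \<Rightarrow> 'r::comm_ring_1 mat"
  assumes res: "free_resolution I r d"
    and g: "\<And>i. \<gamma> i \<in> carrier_mat (r i) (r i)" and g0: "d 0 * \<gamma> 0 = 0\<^sub>m 1 (r 0)"
    and gS: "\<And>i. d (Suc i) * \<gamma> (Suc i) = \<gamma> i * d (Suc i)"
  shows "\<exists>h. (\<forall>i. h i \<in> carrier_mat (r (Suc i)) (r i)) \<and> \<gamma> 0 = d 1 * h 0 \<and>
    (\<forall>i. \<gamma> (Suc i) = d (Suc (Suc i)) * h (Suc i) + h i * d (Suc i))"
proof -
  note c = free_resolution_carrier[OF res] and z = free_resolution_comp[OF res]
  define P where "P i h \<longleftrightarrow> h \<in> carrier_mat (r (Suc i)) (r i) \<and> (i = 0 \<longrightarrow> \<gamma> 0 = d 1 * h) \<and>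
    d (Suc i) * (\<gamma> (Suc i) - h * d (Suc i)) = 0\<^sub>m (r i) (r (Suc i))" for i h
  have "\<exists>h. \<forall>i. P i (h i) \<and> \<gamma> (Suc i) - h i * d (Suc i) = d (Suc (Suc i)) * h (Suc i)"
  proof (rule dependent_nat_choice)
    obtain h where h: "h \<in> carrier_mat (r (Suc 0)) (r 0)" "\<gamma> 0 = d (Suc 0) * h"
      using free_resolution_lift[OF res g[of 0]] g0 c(1) by auto
    have "d (Suc 0) * (\<gamma> (Suc 0) - h * d (Suc 0)) = d (Suc 0) * \<gamma> (Suc 0) - d (Suc 0) * (h * d (Suc 0))"
      using c(2)[of 0] g[of "Suc 0"] h by (auto intro: mult_minus_distrib_mat)
    also have "d (Suc 0) * (h * d (Suc 0)) = \<gamma> 0 * d (Suc 0)"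
      using assoc_mult_mat[OF c(2)[of 0] h(1) c(2)[of 0]] h(2) by simp
    finally show "\<exists>h. P 0 h" using h gS[of 0] c(2)[of 0] g[of 0] by (auto simp: P_def)
  next
    fix h i assume h: "P i h"
    hence hc: "h \<in> carrier_mat (r (Suc i)) (r i)" by (simp add: P_def)
    have "\<gamma> (Suc i) - h * d (Suc i) \<in> carrier_mat (r (Suc i)) (r (Suc i))"
      using g hc c(2) by (intro minus_carrier_mat) auto
    from free_resolution_lift[OF res this] h c(2)[of i]
    obtain k where k: "k \<in> carrier_mat (r (Suc (Suc i))) (r (Suc i))"
      "\<gamma> (Suc i) - h * d (Suc i) = d (Suc (Suc i)) * k" by (auto simp: P_def)
    let ?d = "d (Suc (Suc i))"
    have dc: "?d \<in> carrier_mat (r (Suc i)) (r (Suc (Suc i)))" by (rule c(2))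
    have "?d * (\<gamma> (Suc (Suc i)) - k * ?d) = ?d * \<gamma> (Suc (Suc i)) - ?d * (k * ?d)"
      using dc k(1) by (intro mult_minus_distrib_mat[OF dc g]) auto
    also have "?d * (k * ?d) = (\<gamma> (Suc i) - h * d (Suc i)) * ?d"
      using assoc_mult_mat[OF dc k(1) dc] k(2) by simp
    also have "\<dots> = \<gamma> (Suc i) * ?d - h * d (Suc i) * ?d"
      using hc c(2) by (intro minus_mult_distrib_mat[OF g _ dc]) auto
    also have "h * d (Suc i) * ?d = h * (d (Suc i) * ?d)"
      by (rule assoc_mult_mat[OF hc c(2) dc])
    also have "\<dots> = 0\<^sub>m (r (Suc i)) (r (Suc (Suc i)))"
      using z[of "Suc i"] c(2)[of i] hc by auto
    finally have "?d * (\<gamma> (Suc (Suc i)) - k * ?d) = 0\<^sub>m (r (Suc i)) (r (Suc (Suc i)))"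
      using gS[of "Suc i"] g[of "Suc i"] dc by auto
    thus "\<exists>k. P (Suc i) k \<and> \<gamma> (Suc i) - h * d (Suc i) = ?d * k"
      using k by (auto simp: P_def)
  qed
  then obtain h where h: "\<And>i. P i (h i)"
    "\<And>i. \<gamma> (Suc i) - h i * d (Suc i) = d (Suc (Suc i)) * h (Suc i)" by blast
  have hc: "h i \<in> carrier_mat (r (Suc i)) (r i)" for i using h(1) by (simp add: P_def)
  have "\<gamma> (Suc i) = d (Suc (Suc i)) * h (Suc i) + h i * d (Suc i)" for i
    unfolding h(2)[symmetric] using g[of "Suc i"] hc[of i] c(2)[of i] by (intro eq_matI) auto
  thus ?thesis using hc h(1)[of 0] by (auto simp: P_def)
qed

section \<open>Minimal resolutions after passage to the residue field\<close>

context comm_ring_hom begin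

lemma mat_hom_add:
  assumes "X \<in> carrier_mat nr nc" "Y \<in> carrier_mat nr nc"
  shows "mat\<^sub>h (X + Y) = mat\<^sub>h X + mat\<^sub>h Y"
  using assms by (intro eq_matI) (auto simp: hom_add)

lemma mat_hom_minimal:
  assumes "free_resolution I r d"
    and "\<And>i a b. a < r i \<Longrightarrow> b < r (Suc i) \<Longrightarrow> hom (d (Suc i) $$ (a, b)) = 0"
  shows "mat\<^sub>h (d (Suc i)) = 0\<^sub>m (r i) (r (Suc i))"
  using assms free_resolution_carrier(2)[OF assms(1), of i] by (intro eq_matI) auto

text \<open>Subtracting the identity gives a null-homotopic endomorphism, a sum of terms each
  containing some \<open>d (Suc j)\<close> as a factor. The homomorphism kills all of these
  factors.\<close>

lemma chain_endomorphism_hom_one: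
  assumes res: "free_resolution I r d"
    and min: "\<And>i a b. a < r i \<Longrightarrow> b < r (Suc i) \<Longrightarrow> hom (d (Suc i) $$ (a, b)) = 0"
    and b: "\<And>i. \<beta> i \<in> carrier_mat (r i) (r i)" and b0: "d 0 * \<beta> 0 = d 0"
    and bS: "\<And>i. d (Suc i) * \<beta> (Suc i) = \<beta> i * d (Suc i)"
  shows "mat\<^sub>h (\<beta> i) = 1\<^sub>m (r i)"
proof -
  note c = free_resolution_carrier[OF res]
  note hd = mat_hom_minimal[OF res min]
  define \<gamma> where "\<gamma> i = \<beta> i - 1\<^sub>m (r i)" for i
  have g: "\<gamma> i \<in> carrier_mat (r i) (r i)" for i by (auto simp: \<gamma>_def intro!: minus_carrier_mat)
  have "d 0 * \<gamma> 0 = d 0 * \<beta> 0 - d 0 * 1\<^sub>m (r 0)"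
    unfolding \<gamma>_def by (rule mult_minus_distrib_mat[OF c(1) b]) auto
  hence g0: "d 0 * \<gamma> 0 = 0\<^sub>m 1 (r 0)" using b0 c(1) by auto
  have gS: "d (Suc i) * \<gamma> (Suc i) = \<gamma> i * d (Suc i)" for i
  proof -
    have "d (Suc i) * \<gamma> (Suc i) = d (Suc i) * \<beta> (Suc i) - d (Suc i) * 1\<^sub>m (r (Suc i))"
      unfolding \<gamma>_def by (rule mult_minus_distrib_mat[OF c(2) b]) auto
    also have "\<dots> = \<beta> i * d (Suc i) - 1\<^sub>m (r i) * d (Suc i)" using bS[of i] c(2)[of i] by simp
    also have "\<dots> = \<gamma> i * d (Suc i)"
      unfolding \<gamma>_def by (rule minus_mult_distrib_mat[symmetric, OF b _ c(2)]) auto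
    finally show ?thesis .
  qed
  obtain h where h: "\<And>i. h i \<in> carrier_mat (r (Suc i)) (r i)" "\<gamma> 0 = d 1 * h 0"
    "\<And>i. \<gamma> (Suc i) = d (Suc (Suc i)) * h (Suc i) + h i * d (Suc i)"
    using free_resolution_homotopy[OF res g g0 gS] by blast
  have dh: "mat\<^sub>h (d (Suc i) * h i) = 0\<^sub>m (r i) (r i)" for i
    using mat_hom_mult[OF c(2) h(1)] hd[of i] h(1)[of i] by simp
  have hd': "mat\<^sub>h (h i * d (Suc i)) = 0\<^sub>m (r (Suc i)) (r (Suc i))" for i
    using mat_hom_mult[OF h(1) c(2)] hd[of i] h(1)[of i] by simp
  have gz: "mat\<^sub>h (\<gamma> i) = 0\<^sub>m (r i) (r i)"
  proof (cases i)
    case 0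
    then show ?thesis using h(2) dh[of 0] by simp
  next
    case (Suc j)
    have *: "d (Suc (Suc j)) * h (Suc j) \<in> carrier_mat (r (Suc j)) (r (Suc j))"
      "h j * d (Suc j) \<in> carrier_mat (r (Suc j)) (r (Suc j))"
      using c(2)[of j] c(2)[of "Suc j"] h(1)[of j] h(1)[of "Suc j"] by auto
    have "mat\<^sub>h (\<gamma> i) = mat\<^sub>h (d (Suc (Suc j)) * h (Suc j)) + mat\<^sub>h (h j * d (Suc j))"
      unfolding Suc h(3) by (rule mat_hom_add[OF *])
    thus ?thesis using Suc by (simp add: dh hd')
  qed
  show ?thesis
  proof (rule eq_matI)
    fix a c assume ac: "a < dim_row (1\<^sub>m (r i) :: 'b mat)" "c < dim_col (1\<^sub>m (r i) :: 'b mat)"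
    have "mat\<^sub>h (\<gamma> i) $$ (a, c) = 0" using gz ac by simp
    moreover have "\<gamma> i $$ (a, c) = \<beta> i $$ (a, c) - (if a = c then 1 else 0)"
      using ac b[of i] by (simp add: \<gamma>_def)
    ultimately show "mat\<^sub>h (\<beta> i) $$ (a, c) = 1\<^sub>m (r i) $$ (a, c)"
      using ac b[of i] g[of i] by (auto simp: hom_minus split: if_splits)
  qed (use b[of i] in auto)
qed

end

text \<open>Comparison maps in both directions compose to an endomorphism of the minimal resolution
  \<open>d\<close> over the identity of \<open>I\<close>. Its image over the field is the identity,
  and it factors through dimension \<open>r' i\<close>.\<close>

lemma free_resolution_rank_le:
  fixes hom :: "'r::comm_ring_1 \<Rightarrow> 'k::field"
  assumes hom: "comm_ring_hom hom"
    and res: "free_resolution I r d"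
    and min: "\<And>i a b. a < r i \<Longrightarrow> b < r (Suc i) \<Longrightarrow> hom (d (Suc i) $$ (a, b)) = 0"
    and res': "free_resolution I r' d'"
  shows "r i \<le> r' i"
proof -
  interpret comm_ring_hom hom by (rule hom)
  note c = free_resolution_carrier[OF res] and c' = free_resolution_carrier[OF res']
  obtain \<alpha> where a: "\<And>i. \<alpha> i \<in> carrier_mat (r' i) (r i)" "d' 0 * \<alpha> 0 = d 0"
    "\<And>i. d' (Suc i) * \<alpha> (Suc i) = \<alpha> i * d (Suc i)"
    using free_resolution_comparison[OF res res'] by blast
  obtain \<beta> where b: "\<And>i. \<beta> i \<in> carrier_mat (r i) (r' i)" "d 0 * \<beta> 0 = d' 0"
    "\<And>i. d (Suc i) * \<beta> (Suc i) = \<beta> i * d' (Suc i)"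
    using free_resolution_comparison[OF res' res] by blast
  have "mat\<^sub>h (\<beta> i * \<alpha> i) = 1\<^sub>m (r i)"
  proof (rule chain_endomorphism_hom_one[OF res min])
    show "\<beta> i * \<alpha> i \<in> carrier_mat (r i) (r i)" for i using a(1)[of i] b(1)[of i] by auto
    show "d 0 * (\<beta> 0 * \<alpha> 0) = d 0"
      using assoc_mult_mat[OF c(1) b(1) a(1)] a(2) b(2) by simp
    show "d (Suc i) * (\<beta> (Suc i) * \<alpha> (Suc i)) = \<beta> i * \<alpha> i * d (Suc i)" for i
    proof -
      have "d (Suc i) * (\<beta> (Suc i) * \<alpha> (Suc i)) = \<beta> i * d' (Suc i) * \<alpha> (Suc i)"
        using assoc_mult_mat[OF c(2) b(1) a(1), of i] b(3) by simp
      also have "\<dots> = \<beta> i * (\<alpha> i * d (Suc i))"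
        using assoc_mult_mat[OF b(1) c'(2) a(1), of i] a(3) by simp
      also have "\<dots> = \<beta> i * \<alpha> i * d (Suc i)"
        by (rule assoc_mult_mat[symmetric, OF b(1) a(1) c(2)])
      finally show ?thesis .
    qed
  qed
  hence "mat\<^sub>h (\<beta> i) * mat\<^sub>h (\<alpha> i) = 1\<^sub>m (r i)" using mat_hom_mult[OF b(1) a(1)] by simp
  thus ?thesis using a(1)[of i] b(1)[of i] by (intro mat_mult_one_dim_le) auto
qed

section \<open>Ideals generated by variables\<close>

lemma module_mult: "Modules.module ((*) :: 'r::comm_ring_1 \<Rightarrow> 'r \<Rightarrow> 'r)"
  by unfold_locales (auto simp: algebra_simps)

text \<open>Addition of exponent vectors is cancellative, so a single term of the convolution
  reaches the exponent \<open>s + m\<close>.\<close>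

lemma lookup_single_mult:
  fixes p :: "('v \<Rightarrow>\<^sub>0 nat) \<Rightarrow>\<^sub>0 'k::comm_ring_1"
  shows "Poly_Mapping.lookup (Poly_Mapping.single s 1 * p) (s + m) = Poly_Mapping.lookup p m"
proof -
  have "Poly_Mapping.lookup (Poly_Mapping.single s 1 * p) (s + m) =
      (\<Sum>l. (\<Sum>q. Poly_Mapping.lookup p q when s + m = l + q) when s = l)"
    by (simp add: lookup_mult lookup_single when_mult)
  also have "\<dots> = (\<Sum>q. Poly_Mapping.lookup p q when m = q)"
    by (simp add: Sum_any_when_equal')
  finally show ?thesis by (simp add: Sum_any_when_equal')
qed

lemma lookup_Var_mult:
  fixes p :: "('v, 'k::comm_ring_1) poly_ring"
  shows "Poly_Mapping.lookup (Var v * p) (Poly_Mapping.single v 1 + m) = Poly_Mapping.lookup p m"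
  by (simp only: Var_def lookup_single_mult)

text \<open>Membership in the prime ideal generated by the variables in \<open>W\<close>.\<close>

definition in_vars :: "'v set \<Rightarrow> ('v, 'k::comm_ring_1) poly_ring \<Rightarrow> bool" where
  "in_vars W p \<longleftrightarrow> (\<forall>m\<in>Poly_Mapping.keys p. \<exists>v\<in>W. Poly_Mapping.lookup m v \<noteq> 0)"

lemma in_vars_0 [simp]: "in_vars W 0"
  by (simp add: in_vars_def)

lemma in_vars_add: "in_vars W p \<Longrightarrow> in_vars W q \<Longrightarrow> in_vars W (p + q)"
  using keys_add[of p q] unfolding in_vars_def by blast

lemma keys_uminus_poly: "Poly_Mapping.keys (- p) = Poly_Mapping.keys (p :: 'a \<Rightarrow>\<^sub>0 'k::ab_group_add)"
  by (auto simp: in_keys_iff)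

lemma in_vars_uminus [simp]: "in_vars W (- p) \<longleftrightarrow> in_vars W p"
  by (simp add: in_vars_def keys_uminus_poly)

lemma in_vars_sum: "(\<And>i. i \<in> A \<Longrightarrow> in_vars W (f i)) \<Longrightarrow> in_vars W (sum f A)"
  by (induction A rule: infinite_finite_induct) (auto intro: in_vars_add)

lemma in_vars_mult:
  assumes "in_vars W q" shows "in_vars W (p * q)"
  unfolding in_vars_def
proof
  fix m assume "m \<in> Poly_Mapping.keys (p * q)"
  then obtain a b where "m = a + b" "b \<in> Poly_Mapping.keys q" using keys_mult[of p q] by blast
  moreover then obtain v where "v \<in> W" "Poly_Mapping.lookup b v \<noteq> 0" using assms by (auto simp: in_vars_def)
  ultimately show "\<exists>v\<in>W. Poly_Mapping.lookup m v \<noteq> 0" by (auto simp: lookup_add)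
qed

lemma in_vars_Var: "v \<in> W \<Longrightarrow> in_vars W (Var v)"
  by (force simp: in_vars_def Var_def lookup_single)

lemma in_vars_prod_Var:
  assumes "finite C" "v \<in> C" "v \<in> W" shows "in_vars W (p * (\<Prod>v\<in>C. Var v))"
proof -
  have "(\<Prod>v\<in>C. Var v) = (\<Prod>v\<in>C - {v}. Var v) * Var v"
    using assms(1,2) by (simp add: prod.remove mult.commute)
  moreover have "in_vars W (p * ((\<Prod>v\<in>C - {v}. Var v) * Var v))"
    by (intro in_vars_mult in_vars_Var assms)
  ultimately show ?thesis by metis
qed

text \<open>Multiplication by \<open>Var v\<close> changes exponents at \<open>v\<close> only, so a
  variable of \<open>W\<close> dividing the shifted monomial already divides the original
  one.\<close>

lemma in_vars_Var_cancel:
  fixes p :: "('v, 'k::comm_ring_1) poly_ring"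
  assumes p: "in_vars W (Var v * p)" and v: "v \<notin> W" shows "in_vars W p"
  unfolding in_vars_def
proof
  fix m assume "m \<in> Poly_Mapping.keys p"
  hence "Poly_Mapping.single v 1 + m \<in> Poly_Mapping.keys (Var v * p)"
    using lookup_Var_mult[of v p m] by (simp add: in_keys_iff)
  then obtain w where "w \<in> W" "Poly_Mapping.lookup (Poly_Mapping.single v 1 + m) w \<noteq> 0"
    using p unfolding in_vars_def by blast
  thus "\<exists>v\<in>W. Poly_Mapping.lookup m v \<noteq> 0"
    using v by (auto simp: lookup_add lookup_single when_def split: if_splits)
qed

lemma in_vars_prod_Var_cancel:
  fixes p :: "('v, 'k::comm_ring_1) poly_ring"
  assumes "in_vars W (p * (\<Prod>v\<in>C. Var v))" "C \<inter> W = {}" shows "in_vars W p"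
  using assms
proof (induction C arbitrary: p rule: infinite_finite_induct)
  case (insert v C)
  have "in_vars W (Var v * (p * (\<Prod>v\<in>C. Var v)))"
    using insert.prems insert.hyps by (simp add: algebra_simps)
  hence "in_vars W (p * (\<Prod>v\<in>C. Var v))" 
    by (rule in_vars_Var_cancel) (use insert.prems in auto)
  thus ?case using insert by auto
qed auto

lemma Var_mult_eq_0:
  fixes p :: "('v, 'k::comm_ring_1) poly_ring"
  assumes "Var v * p = 0" shows "p = 0"
proof (rule poly_mapping_eqI)
  show "Poly_Mapping.lookup p m = Poly_Mapping.lookup 0 m" for m
    using lookup_Var_mult[of v p m] assms by simp
qed

lemma prod_Var_mult_eq_0:
  fixes p :: "('v, 'k::comm_ring_1) poly_ring"
  assumes "p * (\<Prod>v\<in>C. Var v) = 0" shows "p = 0"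
  using assms
proof (induction C arbitrary: p rule: infinite_finite_induct)
  case (insert v C)
  have "Var v * (p * (\<Prod>v\<in>C. Var v)) = 0"
    using insert.prems insert.hyps by (simp add: algebra_simps)
  from Var_mult_eq_0[OF this] show ?case by (rule insert.IH)
qed auto

text \<open>Every monomial of \<open>p\<close> is divisible by \<open>Var v\<close>; the quotient
  \<open>q\<close> is read off by shifting exponents, its coefficient at \<open>m\<close> being that
  of \<open>p\<close> at \<open>Var v\<close> times \<open>m\<close>.\<close>

lemma in_vars_singleton:
  fixes p :: "('v, 'k::comm_ring_1) poly_ring"
  assumes "in_vars {v} p" shows "\<exists>q. p = Var v * q"
proof -
  let ?s = "Poly_Mapping.single v (1::nat)"
  define q where "q = Poly_Mapping.map_key (\<lambda>m. ?s + m) p"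
  have q: "Poly_Mapping.lookup q m = Poly_Mapping.lookup p (?s + m)" for m
    unfolding q_def by (subst map_key.rep_eq) (auto simp: inj_def)
  \<comment> \<open>Subtraction of exponents is truncated, hence it is undone only when the exponent
    at \<open>v\<close> is positive.\<close>
  have hit: "?s + (m - ?s) = m" if "Poly_Mapping.lookup m v \<noteq> 0" for m
    using that by (intro poly_mapping_eqI) (auto simp: lookup_add lookup_minus lookup_single when_def)
  have "Poly_Mapping.lookup (Var v * q) m = Poly_Mapping.lookup p m" for m
  proof (cases "Poly_Mapping.lookup m v = 0")
    case True
    have "in_vars {v} (Var v * q)" by (subst mult.commute) (simp add: in_vars_mult in_vars_Var)
    hence "m \<notin> Poly_Mapping.keys (Var v * q)" "m \<notin> Poly_Mapping.keys p"
      using assms True unfolding in_vars_def by blast+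
    thus ?thesis by (simp add: in_keys_iff)
  next
    case False
    from lookup_Var_mult[of v q "m - ?s"] q[of "m - ?s"] hit[OF False] show ?thesis by simp
  qed
  thus ?thesis by (intro exI[of _ q] poly_mapping_eqI) simp
qed

text \<open>The monomials of \<open>p\<close> are separated into those divisible by
  \<open>Var v\<close>, collected in \<open>p1\<close>, and the rest, each of which must contain a
  variable of \<open>W\<close>.\<close>

lemma in_vars_insert:
  fixes p :: "('v, 'k::comm_ring_1) poly_ring"
  assumes "in_vars (insert v W) p" shows "\<exists>q r. p = Var v * q + r \<and> in_vars W r"
proof -
  define p1 where "p1 = Poly_Mapping.mapp (\<lambda>m c. c when Poly_Mapping.lookup m v \<noteq> 0) p"
  have p1: "Poly_Mapping.lookup p1 m = (Poly_Mapping.lookup p m when Poly_Mapping.lookup m v \<noteq> 0)" for m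
    unfolding p1_def by (auto simp: lookup_mapp when_def in_keys_iff)
  have "in_vars {v} p1" by (auto simp: in_vars_def in_keys_iff p1)
  from in_vars_singleton[OF this] obtain q where q: "p1 = Var v * q" by blast
  have "in_vars W (p - p1)"
    unfolding in_vars_def
  proof
    fix m assume "m \<in> Poly_Mapping.keys (p - p1)"
    hence "m \<in> Poly_Mapping.keys p" "Poly_Mapping.lookup m v = 0"
      by (auto simp: in_keys_iff p1 lookup_minus when_def split: if_splits)
    thus "\<exists>v\<in>W. Poly_Mapping.lookup m v \<noteq> 0" using assms by (auto simp: in_vars_def)
  qed
  moreover have "p = Var v * q + (p - p1)" using q by simp
  ultimately show ?thesis by blast
qed

lemma in_vars_two:
  fixes p :: "('v, 'k::comm_ring_1) poly_ring"
  assumes "in_vars {u, v} p" shows "\<exists>q r. p = Var u * q + Var v * r"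
proof -
  from in_vars_insert[OF assms] obtain q r where "p = Var u * q + r" "in_vars {v} r" by blast
  moreover from in_vars_singleton[OF this(2)] obtain r' where "r = Var v * r'" by blast
  ultimately show ?thesis by blast
qed

text \<open>The Koszul relation of two distinct variables: \<open>Var u\<close> divides
  \<open>Var v * g\<close>, hence \<open>g\<close>, and cancelling \<open>Var u\<close> determines
  \<open>h\<close>.\<close>

lemma Var_syzygy:
  fixes g h :: "('v, 'k::comm_ring_1) poly_ring"
  assumes "u \<noteq> v" and e: "Var v * g + Var u * h = 0"
  shows "\<exists>t. g = Var u * t \<and> h = - (Var v * t)"
proof -
  have "Var v * g = - (h * Var u)" using e by (simp add: algebra_simps eq_neg_iff_add_eq_0)
  hence "in_vars {u} (Var v * g)" by (simp add: in_vars_mult in_vars_Var)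
  hence "in_vars {u} g" by (rule in_vars_Var_cancel) (use assms(1) in auto)
  from in_vars_singleton[OF this] obtain t where t: "g = Var u * t" by blast
  have "Var u * (h + Var v * t) = 0" using e t by (simp add: algebra_simps)
  from Var_mult_eq_0[OF this] show ?thesis using t by (auto simp: eq_neg_iff_add_eq_0)
qed

section \<open>Degrees, constant terms and the value of Betti numbers\<close>

lemma monomial_degree_UNIV:
  "monomial_degree (m :: 'v::finite \<Rightarrow>\<^sub>0 nat) = (\<Sum>v\<in>UNIV. Poly_Mapping.lookup m v)"
  unfolding monomial_degree_def by (intro sum.mono_neutral_left) (auto simp: in_keys_iff)

lemma monomial_degree_add:
  "monomial_degree (m + m' :: 'v::finite \<Rightarrow>\<^sub>0 nat) = monomial_degree m + monomial_degree m'"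
  by (simp add: monomial_degree_UNIV lookup_add sum.distrib)

lemma homogeneous_0 [simp]: "homogeneous a 0"
  by (simp add: homogeneous_def)

lemma homogeneous_uminus [simp]: "homogeneous a (- p) \<longleftrightarrow> homogeneous a p"
  by (simp add: homogeneous_def keys_uminus_poly)

lemma homogeneous_Var: "homogeneous 1 (Var v)"
  by (auto simp: homogeneous_def Var_def monomial_degree_def)

lemma homogeneous_mult:
  fixes p q :: "('v::finite, 'k::comm_ring_1) poly_ring"
  assumes "homogeneous a p" "homogeneous b q" shows "homogeneous (a + b) (p * q)"
  unfolding homogeneous_def
proof
  fix m assume "m \<in> Poly_Mapping.keys (p * q)"
  then obtain x y where "m = x + y" "x \<in> Poly_Mapping.keys p" "y \<in> Poly_Mapping.keys q"
    using keys_mult[of p q] by blast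
  thus "int (monomial_degree m) = a + b"
    using assms by (auto simp: homogeneous_def monomial_degree_add)
qed

lemma homogeneous_prod_Var:
  "homogeneous (int (card C)) (\<Prod>v\<in>C. Var v :: ('v::finite, 'k::comm_ring_1) poly_ring)"
proof (induction C rule: infinite_finite_induct)
  case (insert v C)
  thus ?case using homogeneous_mult[OF homogeneous_Var, of "int (card C)"] by simp
qed (auto simp: homogeneous_def monomial_degree_def)

text \<open>Two exponent vectors over the naturals sum to zero only if both vanish, so the constant
  term is multiplicative. This is the map to the field that detects minimality.\<close>

lemma comm_ring_hom_constant_term:
  "comm_ring_hom (\<lambda>p :: ('v, 'k::comm_ring_1) poly_ring. Poly_Mapping.lookup p 0)"
proof
  fix p q :: "('v, 'k) poly_ring"
  have "(0 = l + q) \<longleftrightarrow> l = 0 \<and> q = 0" for l q :: "'v \<Rightarrow>\<^sub>0 nat"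
    by (auto simp: poly_mapping_eq_iff fun_eq_iff lookup_add)
  thus "Poly_Mapping.lookup (p * q) 0 = Poly_Mapping.lookup p 0 * Poly_Mapping.lookup q 0"
    by (simp add: lookup_mult when_mult mult_when flip: when_when)
qed (auto simp: lookup_add lookup_one)

lemma Var_in_irrelevant_ideal: "Var v \<in> irrelevant_ideal" "- Var v \<in> irrelevant_ideal"
    "0 \<in> irrelevant_ideal"
  unfolding irrelevant_ideal_def ideal_gen_def
  by (auto intro!: Modules.module.span_base[OF module_mult] Modules.module.span_neg[OF module_mult]
      Modules.module.span_zero[OF module_mult])

lemma irrelevant_ideal_constant_term:
  assumes "(p :: ('v, 'k::comm_ring_1) poly_ring) \<in> irrelevant_ideal" shows "Poly_Mapping.lookup p 0 = 0"
  using assms unfolding irrelevant_ideal_def ideal_gen_def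
proof (induction rule: Modules.module.span_induct_alt[OF module_mult, consumes 1])
  case (2 c x y)
  interpret comm_ring_hom "\<lambda>p :: ('v, 'k::comm_ring_1) poly_ring. Poly_Mapping.lookup p 0"
    by (rule comm_ring_hom_constant_term)
  have "Poly_Mapping.single v (Suc 0) \<noteq> 0" for v :: 'v
    by (metis lookup_single_eq lookup_zero nat.distinct(1))
  with 2 show ?case by (auto simp: hom_mult hom_add Var_def lookup_single)
qed simp

text \<open>The definite description is justified because the ranks of any two minimal resolutions
  bound each other, by the rank inequality applied both ways.\<close>

lemma betti_eqI:
  fixes I :: "('v, 'k::field) poly_ring set"
  assumes "minimal_graded_free_resolution I r s d"
  shows "betti i I = r i"
proof -
  let ?c = "\<lambda>p :: ('v, 'k) poly_ring. Poly_Mapping.lookup p 0"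
  have le: "r i \<le> r' i" if min: "minimal_graded_free_resolution I r s d"
    and min': "minimal_graded_free_resolution I r' s' d'" for r s d r' s' d'
  proof -
    have res: "free_resolution I r d" and res': "free_resolution I r' d'"
      using min min' by (auto simp: minimal_graded_free_resolution_def graded_free_resolution_def)
    have "?c (d (Suc i) $$ (a, b)) = 0" if "a < r i" "b < r (Suc i)" for i a b
      using min that by (intro irrelevant_ideal_constant_term) (simp add: minimal_graded_free_resolution_def)
    from free_resolution_rank_le[OF comm_ring_hom_constant_term res this res'] show ?thesis by simp
  qed
  show ?thesis
    unfolding betti_def
  proof (rule the_equality)
    show "\<exists>r' s d. minimal_graded_free_resolution I r' s d \<and> r' i = r i" using assms by blast
    fix b assume "\<exists>r s d. minimal_graded_free_resolution I r s d \<and> r i = b"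
    then obtain r' s' d' where "minimal_graded_free_resolution I r' s' d'" "r' i = b" by blast
    thus "b = r i" using le[OF assms, of r' s' d'] le[OF _ assms, of r' s' d'] by simp
  qed
qed

section \<open>Resolutions whose bases are arbitrary finite sets\<close>

definition reindexed_mat where
  "reindexed_mat n e m f \<delta> = mat n m (\<lambda>(i, j). \<delta> (e i) (f j))"

lemma reindexed_mat_carrier [simp]: "reindexed_mat n e m f \<delta> \<in> carrier_mat n m"
  by (simp add: reindexed_mat_def)

lemma reindexed_mat_mult_vec:
  assumes "bij_betw f {0..<m} Y"
  shows "reindexed_mat n e m f \<delta> *\<^sub>v vec m (\<lambda>j. w (f j)) = vec n (\<lambda>i. \<Sum>y\<in>Y. \<delta> (e i) y * w y)"
proof (rule eq_vecI)
  fix i assume "i < dim_vec (vec n (\<lambda>i. \<Sum>y\<in>Y. \<delta> (e i) y * w y))"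
  hence i: "i < n" by simp
  have "(reindexed_mat n e m f \<delta> *\<^sub>v vec m (\<lambda>j. w (f j))) $ i = (\<Sum>j=0..<m. \<delta> (e i) (f j) * w (f j))"
    using i by (auto simp: reindexed_mat_def scalar_prod_def intro!: sum.cong)
  also have "\<dots> = (\<Sum>y\<in>Y. \<delta> (e i) y * w y)" by (rule sum.reindex_bij_betw[OF assms])
  finally show "(reindexed_mat n e m f \<delta> *\<^sub>v vec m (\<lambda>j. w (f j))) $ i =
      vec n (\<lambda>i. \<Sum>y\<in>Y. \<delta> (e i) y * w y) $ i" using i by simp
qed (simp add: reindexed_mat_def)

lemma vec_reindexE:
  assumes "bij_betw f {0..<m} Y" "v \<in> carrier_vec m"
  obtains w where "v = vec m (\<lambda>j. w (f j))"
proof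
  show "v = vec m (\<lambda>j. (\<lambda>y. v $ inv_into {0..<m} f y) (f j))"
    using assms by (intro eq_vecI) (auto simp: bij_betw_def inv_into_f_f)
qed

lemma mat_image_reindexed:
  fixes \<delta> :: "'a \<Rightarrow> 'b \<Rightarrow> 'r::comm_ring_1"
  assumes f: "bij_betw f {0..<m} Y"
  shows "mat_image (reindexed_mat n e m f \<delta>) = range (\<lambda>w. vec n (\<lambda>i. \<Sum>y\<in>Y. \<delta> (e i) y * w y))"
proof -
  have "carrier_vec m = range (\<lambda>w :: 'b \<Rightarrow> 'r. vec m (\<lambda>j. w (f j)))"
    by (auto elim: vec_reindexE[OF f])
  hence "mat_image (reindexed_mat n e m f \<delta>) =
      (\<lambda>v. reindexed_mat n e m f \<delta> *\<^sub>v v) ` range (\<lambda>w. vec m (\<lambda>j. w (f j)))"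
    by (simp add: mat_image_def reindexed_mat_def)
  thus ?thesis by (simp add: image_image reindexed_mat_mult_vec[OF f])
qed

text \<open>Every vector of length \<open>m\<close> is a function on \<open>Y\<close> composed with
  the enumeration \<open>f\<close>, so exactness for functions on index sets carries over to
  matrices.\<close>

lemma mat_kernel_reindexed:
  fixes \<delta> :: "'a \<Rightarrow> 'b \<Rightarrow> 'r::comm_ring_1" and \<epsilon> :: "'b \<Rightarrow> 'c \<Rightarrow> 'r"
  assumes e: "bij_betw e {0..<n} X" and f: "bij_betw f {0..<m} Y" and g: "bij_betw g {0..<k} Z"
    and exact: "\<And>w. (\<forall>x\<in>X. (\<Sum>y\<in>Y. \<delta> x y * w y) = 0) \<longleftrightarrow>
      (\<exists>t. \<forall>y\<in>Y. w y = (\<Sum>z\<in>Z. \<epsilon> y z * t z))"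
  shows "mat_kernel (reindexed_mat n e m f \<delta>) = mat_image (reindexed_mat m f k g \<epsilon>)"
proof -
  have *: "(\<forall>j<m. w (f j) = u (f j)) \<longleftrightarrow> (\<forall>y\<in>Y. w y = u y)" for w u :: "_ \<Rightarrow> 'r"
    using f by (auto simp: bij_betw_def)
  have **: "(\<forall>i<n. u (e i) = 0) \<longleftrightarrow> (\<forall>x\<in>X. u x = 0)" for u :: "_ \<Rightarrow> 'r"
    using e by (auto simp: bij_betw_def)
  have vec_eq: "vec m u = vec m w \<longleftrightarrow> (\<forall>j<m. u j = w j)" for u w :: "nat \<Rightarrow> 'r" and m
    by (auto simp: vec_eq_iff)
  have mem: "vec m (\<lambda>j. w (f j)) \<in> mat_kernel (reindexed_mat n e m f \<delta>) \<longleftrightarrow>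
      vec m (\<lambda>j. w (f j)) \<in> mat_image (reindexed_mat m f k g \<epsilon>)" for w
  proof -
    have "vec m (\<lambda>j. w (f j)) \<in> mat_kernel (reindexed_mat n e m f \<delta>) \<longleftrightarrow>
        vec n (\<lambda>i. \<Sum>y\<in>Y. \<delta> (e i) y * w y) = vec n (\<lambda>i. 0)"
      using mat_kernel[OF reindexed_mat_carrier[of n e m f \<delta>]]
      by (simp add: reindexed_mat_mult_vec[OF f] zero_vec_def)
    also have "\<dots> \<longleftrightarrow> (\<exists>t. \<forall>y\<in>Y. w y = (\<Sum>z\<in>Z. \<epsilon> y z * t z))"
      unfolding vec_eq using **[of "\<lambda>x. \<Sum>y\<in>Y. \<delta> x y * w y"] exact by simp
    also have "\<dots> \<longleftrightarrow> (\<exists>t. vec m (\<lambda>j. w (f j)) = vec m (\<lambda>j. \<Sum>z\<in>Z. \<epsilon> (f j) z * t z))"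
      unfolding vec_eq using *[of w "\<lambda>y. \<Sum>z\<in>Z. \<epsilon> y z * t z" for t] by simp
    also have "\<dots> \<longleftrightarrow> vec m (\<lambda>j. w (f j)) \<in> mat_image (reindexed_mat m f k g \<epsilon>)"
      unfolding mat_image_reindexed[OF g] by blast
    finally show ?thesis .
  qed
  have "mat_kernel (reindexed_mat n e m f \<delta>) \<subseteq> carrier_vec m"
    by (rule mat_kernel_carrier[OF reindexed_mat_carrier])
  moreover have "mat_image (reindexed_mat m f k g \<epsilon>) \<subseteq> carrier_vec m"
    unfolding mat_image_reindexed[OF g] by auto
  moreover have "v \<in> mat_kernel (reindexed_mat n e m f \<delta>) \<longleftrightarrow>
      v \<in> mat_image (reindexed_mat m f k g \<epsilon>)" if "v \<in> carrier_vec m" for v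
    using vec_reindexE[OF f that] mem by metis
  ultimately show ?thesis by blast
qed

text \<open>
  Free modules are given here by finite index sets \<open>X i\<close>, all generators of homological degree
  \<open>i\<close> having internal degree \<open>s i\<close>.
\<close>

lemma minimal_resolution_of_indexed_complex:
  fixes X :: "nat \<Rightarrow> 'b set" and gen :: "'b \<Rightarrow> ('v, 'k::field) poly_ring"
    and \<delta> :: "nat \<Rightarrow> 'b \<Rightarrow> 'b \<Rightarrow> ('v, 'k) poly_ring"
  assumes fin: "\<And>i. finite (X i)"
    and I: "I = range (\<lambda>w. \<Sum>y\<in>X 0. gen y * w y)"
    and exact0: "\<And>w. (\<Sum>y\<in>X 0. gen y * w y) = 0 \<longleftrightarrow>
      (\<exists>t. \<forall>y\<in>X 0. w y = (\<Sum>z\<in>X (Suc 0). \<delta> 0 y z * t z))"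
    and exact: "\<And>i w. (\<forall>x\<in>X i. (\<Sum>y\<in>X (Suc i). \<delta> i x y * w y) = 0) \<longleftrightarrow>
      (\<exists>t. \<forall>y\<in>X (Suc i). w y = (\<Sum>z\<in>X (Suc (Suc i)). \<delta> (Suc i) y z * t z))"
    and hom0: "\<And>y. y \<in> X 0 \<Longrightarrow> homogeneous (s 0) (gen y)"
    and hom: "\<And>i x y. x \<in> X i \<Longrightarrow> y \<in> X (Suc i) \<Longrightarrow> homogeneous (s (Suc i) - s i) (\<delta> i x y)"
    and min: "\<And>i x y. x \<in> X i \<Longrightarrow> y \<in> X (Suc i) \<Longrightarrow> \<delta> i x y \<in> irrelevant_ideal"
  shows "\<exists>d. minimal_graded_free_resolution I (\<lambda>i. card (X i)) (\<lambda>i _. s i) d"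
proof -
  define r where "r = (\<lambda>i. card (X i))"
  have "\<exists>e. bij_betw e {0..<r i} (X i)" for i
    unfolding r_def using ex_bij_betw_nat_finite[OF fin] by blast
  then obtain e where e: "\<And>i. bij_betw (e i) {0..<r i} (X i)" by metis
  have eX: "e i j \<in> X i" if "j < r i" for i j using e[of i] that by (auto simp: bij_betw_def)
  define d where "d i = (case i of
      0 \<Rightarrow> reindexed_mat 1 (\<lambda>_. ()) (r 0) (e 0) (\<lambda>_. gen)
    | Suc j \<Rightarrow> reindexed_mat (r j) (e j) (r (Suc j)) (e (Suc j)) (\<delta> j))" for i
  have d0: "d 0 = reindexed_mat 1 (\<lambda>_. ()) (r 0) (e 0) (\<lambda>_. gen)"
    and dS: "\<And>j. d (Suc j) = reindexed_mat (r j) (e j) (r (Suc j)) (e (Suc j)) (\<delta> j)"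
    by (simp_all add: d_def)
  \<comment> \<open>The augmentation is a one-row matrix; indexing its row by the unit type lets the
    transfer of exactness cover degree zero as well.\<close>
  have unit: "bij_betw (\<lambda>_. ()) {0..<1::nat} {()}" by (auto simp: bij_betw_def)
  have "mat_kernel (d i) = mat_image (d (Suc i))" for i
  proof (cases i)
    case 0
    show ?thesis unfolding 0 d0 dS by (rule mat_kernel_reindexed[OF unit e e]) (simp add: exact0)
  next
    case (Suc j)
    show ?thesis unfolding Suc dS by (rule mat_kernel_reindexed[OF e e e exact])
  qed
  moreover have "mat_image (d 0) = (\<lambda>p. vec 1 (\<lambda>_. p)) ` I"
    unfolding d0 mat_image_reindexed[OF e] I by (auto simp: image_image)
  ultimately have "free_resolution I r d"
    unfolding free_resolution_def by (auto simp: d0 dS)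
  moreover have "homogeneous (s 0) (d 0 $$ (0, b))" if "b < r 0" for b
    using that eX hom0 by (simp add: d0 reindexed_mat_def)
  moreover have "homogeneous (s (Suc i) - s i) (d (Suc i) $$ (a, b))"
      "d (Suc i) $$ (a, b) \<in> irrelevant_ideal" if "a < r i" "b < r (Suc i)" for i a b
    using that eX hom min by (simp_all add: dS reindexed_mat_def)
  ultimately show ?thesis
    unfolding minimal_graded_free_resolution_def graded_free_resolution_def r_def by blast
qed

lemma ideal_gen_image:
  fixes gen :: "'b \<Rightarrow> 'r::comm_ring_1"
  assumes "finite X"
  shows "ideal_gen (gen ` X) = range (\<lambda>w. \<Sum>y\<in>X. gen y * w y)"
proof
  show "ideal_gen (gen ` X) \<subseteq> range (\<lambda>w. \<Sum>y\<in>X. gen y * w y)"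
  proof
    fix p assume "p \<in> ideal_gen (gen ` X)"
    thus "p \<in> range (\<lambda>w. \<Sum>y\<in>X. gen y * w y)"
      unfolding ideal_gen_def
    proof (induction rule: Modules.module.span_induct_alt[OF module_mult, consumes 1])
      case 1
      show ?case by (rule range_eqI[of _ _ "\<lambda>_. 0"]) simp
    next
      case (2 c x y)
      then obtain z w where z: "z \<in> X" "x = gen z" and w: "y = (\<Sum>y\<in>X. gen y * w y)" by blast
      have "c * x + y = (\<Sum>y\<in>X. gen y * (w y + (if y = z then c else 0)))"
        using z assms by (simp add: w distrib_left sum.distrib mult.commute if_distrib[of "\<lambda>x. _ * x"] cong: if_cong)
      thus ?case by (rule range_eqI[where x = "\<lambda>y. w y + (if y = z then c else 0)"])
    qed
  qed
  have "(\<Sum>y\<in>X. w y * gen y) \<in> ideal_gen (gen ` X)" for w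
    unfolding ideal_gen_def
    by (intro Modules.module.span_sum[OF module_mult] Modules.module.span_scale[OF module_mult]
        Modules.module.span_base[OF module_mult] imageI)
  thus "range (\<lambda>w. \<Sum>y\<in>X. gen y * w y) \<subseteq> ideal_gen (gen ` X)" by (auto simp: mult.commute)
qed

section \<open>The resolution of the cover ideal\<close>

lemma sum_delta_mult:
  fixes c g :: "'a \<Rightarrow> 'r::semiring_0"
  assumes "finite Q"
  shows "(\<Sum>q\<in>Q. (if p = q then c q else 0) * g q) = (if p \<in> Q then c p * g p else 0)"
  using assms by (simp add: if_distrib[of "\<lambda>x. x * _"] sum.delta' cong: if_cong)

lemma sum_two:
  assumes "finite Q" "x \<in> Q" "y \<in> Q" "x \<noteq> y" "\<And>q. q \<in> Q \<Longrightarrow> q \<noteq> x \<Longrightarrow> q \<noteq> y \<Longrightarrow> f q = 0"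
  shows "sum f Q = f x + (f y :: 'c::comm_monoid_add)"
proof -
  have "sum f Q = sum f {x, y}" using assms by (intro sum.mono_neutral_right) auto
  thus ?thesis using assms(4) by simp
qed

text \<open>\<open>P\<close> is the edge set of the complement of the graph whose cover ideal is resolved.\<close>

locale spanned_bipartite =
  fixes A B :: "'v::finite set" and P :: "('v \<times> 'v) set" and a0 b0 :: 'v
  assumes disj: "A \<inter> B = {}" and cover: "A \<union> B = UNIV" and sub: "P \<subseteq> A \<times> B"
    and a0: "a0 \<in> A" "\<And>b. b \<in> B \<Longrightarrow> (a0, b) \<in> P"
    and b0: "b0 \<in> B" "\<And>a. a \<in> A \<Longrightarrow> (a, b0) \<in> P"
begin

text \<open>The stars of \<open>a0\<close> and \<open>b0\<close> together form a spanning tree of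
  the bipartite graph \<open>P\<close>. \<open>PA\<close> and \<open>PB\<close> each omit one star
  and index the first syzygies; \<open>PAB\<close>, the edges outside the tree, indexes the second
  syzygies.\<close>

definition PA where "PA = {p \<in> P. fst p \<noteq> a0}"
definition PB where "PB = {p \<in> P. snd p \<noteq> b0}"
definition PAB where "PAB = {p \<in> P. fst p \<noteq> a0 \<and> snd p \<noteq> b0}"

definition gen :: "'v \<times> 'v \<Rightarrow> ('v, 'k::field) poly_ring" where
  "gen p = (\<Prod>v\<in>- {fst p, snd p}. Var v)"

text \<open>The columns of \<open>KA\<close> and \<open>KB\<close> are the relations between the generators of two edges that
  share an end, in \<open>B\<close> and in \<open>A\<close> respectively.\<close>

definition KA :: "'v \<times> 'v \<Rightarrow> 'v \<times> 'v \<Rightarrow> ('v, 'k::field) poly_ring" where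
  "KA p q = (if p = q then Var (fst q) else if p = (a0, snd q) then - Var a0 else 0)"

definition KB :: "'v \<times> 'v \<Rightarrow> 'v \<times> 'v \<Rightarrow> ('v, 'k::field) poly_ring" where
  "KB p q = (if p = q then Var (snd q) else if p = (fst q, b0) then - Var b0 else 0)"

text \<open>The first differential applied to a pair of coefficient families: \<open>g\<close> on
  the relations \<open>KB\<close>, \<open>h\<close> on the relations \<open>KA\<close>.\<close>

definition D1 where
  "D1 g h p = (\<Sum>q\<in>PB. KB p q * g q) + (\<Sum>q\<in>PA. KA p q * h q)"

lemma subsets: "PA \<subseteq> P" "PB \<subseteq> P" "PAB \<subseteq> PA" "PAB \<subseteq> PB"
  by (auto simp: PA_def PB_def PAB_def)

lemma P_neq: "(a, b) \<in> P \<Longrightarrow> a \<noteq> b"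
  using sub disj by auto

lemma spanning_edges:
  "p \<in> P \<Longrightarrow> (fst p, b0) \<in> P" "p \<in> P \<Longrightarrow> (a0, snd p) \<in> P"
  using sub a0 b0 by auto

lemma KB_in_B: "snd p \<noteq> b0 \<Longrightarrow> KB p q = (if p = q then Var (snd q) else 0)"
  by (auto simp: KB_def)

lemma KA_in_A: "fst p \<noteq> a0 \<Longrightarrow> KA p q = (if p = q then Var (fst q) else 0)"
  by (auto simp: KA_def)

lemma sum_KB_in_B:
  "snd p \<noteq> b0 \<Longrightarrow> (\<Sum>q\<in>Q. KB p q * g q) = (if p \<in> Q then Var (snd p) * g p else 0)"
  by (simp add: KB_in_B sum_delta_mult[where c = "\<lambda>q. Var (snd q)"])

lemma sum_KA_in_A:
  "fst p \<noteq> a0 \<Longrightarrow> (\<Sum>q\<in>Q. KA p q * g q) = (if p \<in> Q then Var (fst p) * g p else 0)"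
  by (simp add: KA_in_A sum_delta_mult[where c = "\<lambda>q. Var (fst q)"])

lemma D1_PAB: "p \<in> PAB \<Longrightarrow> D1 g h p = Var (snd p) * g p + Var (fst p) * h p"
  by (auto simp: D1_def sum_KB_in_B sum_KA_in_A PAB_def PA_def PB_def)

text \<open>A column \<open>q\<close> of \<open>KA\<close> meets the row \<open>p\<close> only if
  \<open>p = q\<close> or \<open>p = (a0, snd q)\<close>. As \<open>snd p \<noteq> b0\<close>, such
  a \<open>q\<close> lies in \<open>PAB\<close>, where \<open>h\<close> vanishes.\<close>

lemma D1_PB:
  assumes "p \<in> PB" "\<And>q. q \<in> PAB \<Longrightarrow> h q = 0"
  shows "D1 g h p = Var (snd p) * g p"
proof -
  have "(\<Sum>q\<in>PA. KA p q * h q) = 0"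
    using assms by (intro sum.neutral) (auto simp: KA_def PAB_def PA_def PB_def)
  thus ?thesis using assms(1) by (simp add: D1_def sum_KB_in_B PB_def)
qed

lemma D1_PA:
  assumes "p \<in> PA" "\<And>q. q \<in> PAB \<Longrightarrow> g q = 0"
  shows "D1 g h p = Var (fst p) * h p"
proof -
  have "(\<Sum>q\<in>PB. KB p q * g q) = 0"
    using assms by (intro sum.neutral) (auto simp: KB_def PAB_def PA_def PB_def)
  thus ?thesis using assms(1) by (simp add: D1_def sum_KA_in_A PA_def)
qed

lemma D1_add: "D1 (\<lambda>q. g q + g' q) (\<lambda>q. h q + h' q) p = D1 g h p + D1 g' h' p"
  by (simp add: D1_def distrib_left sum.distrib)

lemma D1_diff: "D1 (\<lambda>q. g q - g' q) (\<lambda>q. h q - h' q) p = D1 g h p - D1 g' h' p"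
  by (simp add: D1_def right_diff_distrib sum_subtractf)

lemma gen_Var: "p \<in> P \<Longrightarrow> gen p * Var (snd p) = (\<Prod>v\<in>- {fst p}. Var v)"
    "p \<in> P \<Longrightarrow> gen p * Var (fst p) = (\<Prod>v\<in>- {snd p}. Var v)"
proof -
  assume "p \<in> P"
  hence ne: "fst p \<noteq> snd p" using P_neq by (cases p) auto
  have "- {fst p} = insert (snd p) (- {fst p, snd p})" "- {snd p} = insert (fst p) (- {fst p, snd p})"
    using ne by auto
  thus "gen p * Var (snd p) = (\<Prod>v\<in>- {fst p}. Var v)" "gen p * Var (fst p) = (\<Prod>v\<in>- {snd p}. Var v)"
    by (simp_all add: gen_def mult.commute)
qed

text \<open>Column \<open>q\<close> has two nonzero entries, at \<open>q\<close> and
  \<open>(fst q, b0)\<close>. Multiplied by their generators, they give the product of all variables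
  except that of \<open>fst q\<close>, with opposite signs.\<close>

lemma gen_KB:
  assumes q: "q \<in> PB"
  shows "(\<Sum>p\<in>P. gen p * KB p q) = (0 :: ('v, 'k::field) poly_ring)"
proof -
  from q have *: "q \<in> P" "(fst q, b0) \<in> P" "q \<noteq> (fst q, b0)"
    using spanning_edges by (cases q; auto simp: PB_def)+
  have "(\<Sum>p\<in>P. gen p * KB p q) = (gen q * KB q q + gen (fst q, b0) * KB (fst q, b0) q :: ('v, 'k) poly_ring)"
    using * by (intro sum_two) (auto simp: KB_def)
  also have "\<dots> = gen q * Var (snd q) - gen (fst q, b0) * Var b0"
    using * by (simp add: KB_def)
  finally show ?thesis by (simp add: gen_Var(1)[OF *(1)] gen_Var(1)[OF *(2), simplified])
qed

lemma gen_KA: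
  assumes q: "q \<in> PA"
  shows "(\<Sum>p\<in>P. gen p * KA p q) = (0 :: ('v, 'k::field) poly_ring)"
proof -
  from q have *: "q \<in> P" "(a0, snd q) \<in> P" "q \<noteq> (a0, snd q)"
    using spanning_edges by (cases q; auto simp: PA_def)+
  have "(\<Sum>p\<in>P. gen p * KA p q) = (gen q * KA q q + gen (a0, snd q) * KA (a0, snd q) q :: ('v, 'k) poly_ring)"
    using * by (intro sum_two) (auto simp: KA_def)
  also have "\<dots> = gen q * Var (fst q) - gen (a0, snd q) * Var a0"
    using * by (simp add: KA_def)
  finally show ?thesis by (simp add: gen_Var(2)[OF *(1)] gen_Var(2)[OF *(2), simplified])
qed

lemma gen_D1: "(\<Sum>p\<in>P. gen p * D1 g h p) = 0"
proof -
  have "(\<Sum>p\<in>P. gen p * D1 g h p) =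
      (\<Sum>q\<in>PB. \<Sum>p\<in>P. gen p * (KB p q * g q)) + (\<Sum>q\<in>PA. \<Sum>p\<in>P. gen p * (KA p q * h q))"
    by (simp add: D1_def distrib_left sum.distrib sum_distrib_left sum.swap[of _ P])
  also have "\<dots> = (\<Sum>q\<in>PB. (\<Sum>p\<in>P. gen p * KB p q) * g q) + (\<Sum>q\<in>PA. (\<Sum>p\<in>P. gen p * KA p q) * h q)"
    by (simp add: sum_distrib_right mult.assoc)
  finally show ?thesis by (simp add: gen_KA gen_KB)
qed

text \<open>Modulo the variables in \<open>W\<close>, a generator \<open>gen q\<close> survives only if \<open>W\<close> consists of ends of \<open>q\<close>.\<close>

lemma in_vars_coefficient:
  assumes w: "(\<Sum>p\<in>P. gen p * w p) = 0" and p: "p \<in> P" and W: "W \<subseteq> {fst p, snd p}"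
    and hit: "\<And>q. q \<in> P \<Longrightarrow> q \<noteq> p \<Longrightarrow> w q \<noteq> 0 \<Longrightarrow> \<not> W \<subseteq> {fst q, snd q}"
  shows "in_vars W (w p :: ('v, 'k::field) poly_ring)"
proof -
  have "gen p * w p = - (\<Sum>q\<in>P - {p}. gen q * w q)"
    using w p by (simp add: sum.remove[of P p] eq_neg_iff_add_eq_0)
  moreover have "in_vars W (gen q * w q)" if q: "q \<in> P - {p}" for q
  proof (cases "w q = 0")
    case False
    then obtain v where "v \<in> W" "v \<in> - {fst q, snd q}" using hit[of q] q by blast
    hence "in_vars W (w q * gen q)" unfolding gen_def by (intro in_vars_prod_Var) auto
    thus ?thesis by (simp add: mult.commute)
  qed simp
  ultimately have "in_vars W (gen p * w p)" by (simp only: in_vars_uminus in_vars_sum)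
  hence "in_vars W (w p * gen p)" by (simp only: mult.commute)
  thus ?thesis unfolding gen_def by (rule in_vars_prod_Var_cancel) (use W in auto)
qed

text \<open>A relation \<open>w\<close> is reduced by elements of the image of \<open>D1\<close> in
  stages: first on the edges outside both stars, then on the stars away from their common edge. The
  coefficient left on \<open>(a0, b0)\<close> vanishes because its generator is not a zero
  divisor.\<close>

lemma exact_gen:
  fixes w :: "'v \<times> 'v \<Rightarrow> ('v, 'k::field) poly_ring"
  shows "(\<Sum>p\<in>P. gen p * w p) = 0 \<longleftrightarrow> (\<exists>g h. \<forall>p\<in>P. w p = D1 g h p)"
proof
  assume "\<exists>g h. \<forall>p\<in>P. w p = D1 g h p"
  thus "(\<Sum>p\<in>P. gen p * w p) = 0" using gen_D1 by auto
next
  assume w: "(\<Sum>p\<in>P. gen p * w p) = 0"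
  \<comment> \<open>Modulo both variables of the ends of \<open>p\<close>, every generator other
    than \<open>gen p\<close> vanishes, so \<open>w p\<close> lies in the ideal of these two
    variables.\<close>
  have "\<exists>g h. w p = Var (snd p) * g + Var (fst p) * h" if p: "p \<in> PAB" for p
  proof (rule in_vars_two, rule in_vars_coefficient[OF w])
    fix q assume q: "q \<in> P" "q \<noteq> p"
    have "fst p \<in> A" "snd p \<in> B" "fst q \<in> A" "snd q \<in> B" using p q sub by (auto simp: PAB_def)
    thus "\<not> {snd p, fst p} \<subseteq> {fst q, snd q}" using q disj by (auto simp: prod_eq_iff)
  qed (use p in \<open>auto simp: PAB_def\<close>)
  then obtain g1 h1 where gh: "\<And>p. p \<in> PAB \<Longrightarrow> w p = Var (snd p) * g1 p + Var (fst p) * h1 p" by metis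
  define w' where "w' p = w p - D1 g1 h1 p" for p
  have w'0: "w' p = 0" if "p \<in> PAB" for p using gh that by (simp add: w'_def D1_PAB)
  have w': "(\<Sum>p\<in>P. gen p * w' p) = 0"
    using w gen_D1[of g1 h1] by (simp add: w'_def right_diff_distrib sum_subtractf)
  have side: "fst q = a0 \<or> snd q = b0" if "q \<in> P" "w' q \<noteq> 0" for q
    using that w'0[of q] by (auto simp: PAB_def)
  \<comment> \<open>The support of \<open>w'\<close> now lies in the two stars. Among its edges,
    \<open>p\<close> is the only one through \<open>snd p\<close>, so a single variable
    suffices.\<close>
  have "\<exists>g. w' p = Var (snd p) * g" if p: "p \<in> PB - PAB" for p
  proof (rule in_vars_singleton, rule in_vars_coefficient[OF w'])
    fix q assume q: "q \<in> P" "q \<noteq> p" "w' q \<noteq> 0"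
    have "fst p = a0" "snd p \<noteq> b0" "fst q \<in> A" "snd p \<in> B" using p q sub by (auto simp: PAB_def PB_def)
    thus "\<not> {snd p} \<subseteq> {fst q, snd q}" using q disj side[OF q(1,3)] by (auto simp: prod_eq_iff)
  qed (use p in \<open>auto simp: PB_def\<close>)
  then obtain g2 where g2: "\<And>p. p \<in> PB - PAB \<Longrightarrow> w' p = Var (snd p) * g2 p" by metis
  have "\<exists>h. w' p = Var (fst p) * h" if p: "p \<in> PA - PAB" for p
  proof (rule in_vars_singleton, rule in_vars_coefficient[OF w'])
    fix q assume q: "q \<in> P" "q \<noteq> p" "w' q \<noteq> 0"
    have "snd p = b0" "fst p \<noteq> a0" "snd q \<in> B" "fst p \<in> A" using p q sub by (auto simp: PAB_def PA_def)
    thus "\<not> {fst p} \<subseteq> {fst q, snd q}" using q disj side[OF q(1,3)] by (auto simp: prod_eq_iff)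
  qed (use p in \<open>auto simp: PA_def\<close>)
  then obtain h2 where h2: "\<And>p. p \<in> PA - PAB \<Longrightarrow> w' p = Var (fst p) * h2 p" by metis
  \<comment> \<open>Coefficients zero on \<open>PAB\<close> keep the vanishing already achieved
    there and make \<open>D1\<close> diagonal on \<open>PB\<close> and \<open>PA\<close>.\<close>
  define g3 where "g3 p = (if p \<in> PAB then 0 else g2 p)" for p
  define h3 where "h3 p = (if p \<in> PAB then 0 else h2 p)" for p
  define w'' where "w'' p = w' p - D1 g3 h3 p" for p
  have w'': "(\<Sum>p\<in>P. gen p * w'' p) = 0"
    using w' gen_D1[of g3 h3] by (simp add: w''_def right_diff_distrib sum_subtractf)
  have B0: "w'' p = 0" if "p \<in> PB" for p
    using D1_PB[OF that, of h3 g3] g2[of p] w'0[of p] that by (auto simp: w''_def h3_def g3_def)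
  have A0: "w'' p = 0" if "p \<in> PA" for p
    using D1_PA[OF that, of g3 h3] h2[of p] w'0[of p] that by (auto simp: w''_def h3_def g3_def)
  have 0: "(a0, b0) \<in> P" using a0 b0 by simp
  have other: "w'' p = 0" if "p \<in> P" "p \<noteq> (a0, b0)" for p
    using that A0 B0 by (cases p) (auto simp: PA_def PB_def)
  have "(\<Sum>p\<in>P. gen p * w'' p) = (\<Sum>p\<in>{(a0, b0)}. gen p * w'' p)"
    using 0 other by (intro sum.mono_neutral_right) auto
  hence "w'' (a0, b0) * gen (a0, b0) = 0" using w'' by (simp add: mult.commute)
  hence "w'' (a0, b0) = 0" unfolding gen_def by (rule prod_Var_mult_eq_0)
  hence "\<forall>p\<in>P. w p = D1 (\<lambda>q. g1 q + g3 q) (\<lambda>q. h1 q + h3 q) p"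
    using other by (auto simp: D1_add w''_def w'_def algebra_simps eq_diff_eq dest!: bspec)
  thus "\<exists>g h. \<forall>p\<in>P. w p = D1 g h p" by blast
qed

text \<open>\<open>KA\<close> moves only the end in \<open>A\<close> and \<open>KB\<close> only the
  end in \<open>B\<close>. Both composites of a column \<open>(a, b)\<close> are supported on the
  square \<open>(a, b)\<close>, \<open>(a0, b)\<close>, \<open>(a, b0)\<close>,
  \<open>(a0, b0)\<close> with equal entries.\<close>

lemma KB_KA_commute:
  assumes r: "r \<in> PAB"
  shows "(\<Sum>q\<in>PB. KB p q * KA q r) = (\<Sum>q\<in>PA. KA p q * KB q r :: ('v, 'k::field) poly_ring)"
proof -
  obtain a b where ab: "r = (a, b)" "a \<noteq> a0" "b \<noteq> b0" "(a, b) \<in> P" using r by (cases r) (auto simp: PAB_def)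
  have P: "(a0, b) \<in> P" "(a, b0) \<in> P" using spanning_edges[OF ab(4)] by auto
  have sum_PB: "(\<Sum>q\<in>PB. KB p q * KA q r) =
      (KB p (a, b) * KA (a, b) r + KB p (a0, b) * KA (a0, b) r :: ('v, 'k) poly_ring)"
    using ab P by (intro sum_two) (auto simp: KA_def PB_def)
  have sum_PA: "(\<Sum>q\<in>PA. KA p q * KB q r) =
      (KA p (a, b) * KB (a, b) r + KA p (a, b0) * KB (a, b0) r :: ('v, 'k) poly_ring)"
    using ab P by (intro sum_two) (auto simp: KB_def PA_def)
  show ?thesis unfolding sum_PB sum_PA using ab by (auto simp: KA_def KB_def)
qed

text \<open>The minus sign on the second family turns the commutation of \<open>KA\<close> and
  \<open>KB\<close> into cancellation, so consecutive maps compose to zero.\<close>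

lemma D1_D2: "D1 (\<lambda>p. \<Sum>q\<in>PAB. KA p q * t q) (\<lambda>p. - (\<Sum>q\<in>PAB. KB p q * t q)) p = 0"
proof -
  have "(\<Sum>q\<in>PB. KB p q * (\<Sum>r\<in>PAB. KA q r * t r)) = (\<Sum>r\<in>PAB. (\<Sum>q\<in>PB. KB p q * KA q r) * t r)"
    by (simp add: sum_distrib_left sum_distrib_right mult.assoc sum.swap[of _ PB])
  also have "\<dots> = (\<Sum>r\<in>PAB. (\<Sum>q\<in>PA. KA p q * KB q r) * t r)" by (simp add: KB_KA_commute)
  also have "\<dots> = (\<Sum>q\<in>PA. KA p q * (\<Sum>r\<in>PAB. KB q r * t r))"
    by (simp add: sum_distrib_left sum_distrib_right mult.assoc sum.swap[of _ PA])
  finally show ?thesis by (simp add: D1_def sum_negf)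
qed

text \<open>On each edge of \<open>PAB\<close> the equation is a syzygy of two distinct variables
  and yields \<open>t\<close> there. After subtraction of the second syzygies with coefficients
  \<open>t\<close>, nothing remains.\<close>

lemma exact_D1:
  fixes g h :: "'v \<times> 'v \<Rightarrow> ('v, 'k::field) poly_ring"
  shows "(\<forall>p\<in>P. D1 g h p = 0) \<longleftrightarrow>
    (\<exists>t. (\<forall>p\<in>PB. g p = (\<Sum>q\<in>PAB. KA p q * t q)) \<and> (\<forall>p\<in>PA. h p = - (\<Sum>q\<in>PAB. KB p q * t q)))"
proof
  assume "\<exists>t. (\<forall>p\<in>PB. g p = (\<Sum>q\<in>PAB. KA p q * t q)) \<and> (\<forall>p\<in>PA. h p = - (\<Sum>q\<in>PAB. KB p q * t q))"
  then obtain t where t: "\<forall>p\<in>PB. g p = (\<Sum>q\<in>PAB. KA p q * t q)" "\<forall>p\<in>PA. h p = - (\<Sum>q\<in>PAB. KB p q * t q)"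
    by blast
  have "D1 g h p = D1 (\<lambda>p. \<Sum>q\<in>PAB. KA p q * t q) (\<lambda>p. - (\<Sum>q\<in>PAB. KB p q * t q)) p" for p
    unfolding D1_def using t by (intro arg_cong2[where f = "(+)"] sum.cong) simp_all
  thus "\<forall>p\<in>P. D1 g h p = 0" by (simp add: D1_D2)
next
  assume D: "\<forall>p\<in>P. D1 g h p = 0"
  have "\<exists>t. g p = Var (fst p) * t \<and> h p = - (Var (snd p) * t)" if p: "p \<in> PAB" for p
  proof (rule Var_syzygy)
    have "p \<in> P" using p by (simp add: PAB_def)
    thus "fst p \<noteq> snd p" using P_neq by (cases p) auto
    show "Var (snd p) * g p + Var (fst p) * h p = 0" using D \<open>p \<in> P\<close> D1_PAB[OF p, of g h] by simp
  qed
  then obtain t where t: "\<And>p. p \<in> PAB \<Longrightarrow> g p = Var (fst p) * t p \<and> h p = - (Var (snd p) * t p)" by metis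
  define g' where "g' p = g p - (\<Sum>q\<in>PAB. KA p q * t q)" for p
  define h' where "h' p = h p - - (\<Sum>q\<in>PAB. KB p q * t q)" for p
  have D': "D1 g' h' p = 0" if "p \<in> P" for p
    using D that unfolding g'_def h'_def D1_diff by (simp add: D1_D2)
  have z: "g' p = 0" "h' p = 0" if "p \<in> PAB" for p
  proof -
    have "fst p \<noteq> a0" "snd p \<noteq> b0" using that by (auto simp: PAB_def)
    thus "g' p = 0" "h' p = 0" using t[OF that] that by (simp_all add: g'_def h'_def sum_KA_in_A sum_KB_in_B)
  qed
  \<comment> \<open>Since \<open>g'\<close> and \<open>h'\<close> vanish on \<open>PAB\<close>, each
    equation on \<open>PB\<close> or \<open>PA\<close> reduces to one variable times one
    coefficient.\<close>
  have "g' p = 0" if "p \<in> PB" for p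
    using D1_PB[OF that, of h' g'] D'[of p] that subsets z by (auto intro: Var_mult_eq_0[of "snd p"])
  moreover have "h' p = 0" if "p \<in> PA" for p
    using D1_PA[OF that, of g' h'] D'[of p] that subsets z by (auto intro: Var_mult_eq_0[of "fst p"])
  ultimately show "\<exists>t. (\<forall>p\<in>PB. g p = (\<Sum>q\<in>PAB. KA p q * t q)) \<and> (\<forall>p\<in>PA. h p = - (\<Sum>q\<in>PAB. KB p q * t q))"
    by (intro exI[of _ t]) (simp add: g'_def h'_def eq_neg_iff_add_eq_0)
qed

text \<open>The tag separates the two families of relations in homological degree one.\<close>

definition cells :: "nat \<Rightarrow> (bool \<times> 'v \<times> 'v) set" where
  "cells i = (if i = 0 then {False} \<times> P else if i = 1 then {False} \<times> PB \<union> {True} \<times> PA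
    else if i = 2 then {False} \<times> PAB else {})"

text \<open>In degree zero the tag of the column selects the family of relations; from degree one on
  the tag of the row selects the component, with the sign that makes the maps compose to
  zero.\<close>

definition diff :: "nat \<Rightarrow> bool \<times> 'v \<times> 'v \<Rightarrow> bool \<times> 'v \<times> 'v \<Rightarrow> ('v, 'k::field) poly_ring" where
  "diff i x y = (if i = 0 then (if fst y then KA (snd x) (snd y) else KB (snd x) (snd y))
    else (if fst x then - KB (snd x) (snd y) else KA (snd x) (snd y)))"

lemma sum_cells:
  "(\<Sum>y\<in>cells 0. f y) = (\<Sum>p\<in>P. f (False, p))"
  "(\<Sum>y\<in>cells (Suc 0). f y) = (\<Sum>p\<in>PB. f (False, p)) + (\<Sum>p\<in>PA. f (True, p))"
  "(\<Sum>y\<in>cells (Suc (Suc 0)). f y) = (\<Sum>p\<in>PAB. f (False, p))"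
proof -
  have "sum f ({False} \<times> PB \<union> {True} \<times> PA) = sum f ({False} \<times> PB) + sum f ({True} \<times> PA)"
    by (intro sum.union_disjoint) auto
  thus "(\<Sum>y\<in>cells (Suc 0). f y) = (\<Sum>p\<in>PB. f (False, p)) + (\<Sum>p\<in>PA. f (True, p))"
    by (simp add: cells_def sum.cartesian_product')
qed (simp_all add: cells_def sum.cartesian_product')

lemma exact_cells0:
  fixes w :: "bool \<times> 'v \<times> 'v \<Rightarrow> ('v, 'k::field) poly_ring"
  shows "(\<Sum>y\<in>cells 0. gen (snd y) * w y) = 0 \<longleftrightarrow>
    (\<exists>t. \<forall>y\<in>cells 0. w y = (\<Sum>z\<in>cells (Suc 0). diff 0 y z * t z))"
proof -
  have "(\<Sum>y\<in>cells 0. gen (snd y) * w y) = 0 \<longleftrightarrow> (\<exists>g h. \<forall>p\<in>P. w (False, p) = D1 g h p)"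
    by (simp add: sum_cells exact_gen)
  also have "\<dots> \<longleftrightarrow> (\<exists>t. \<forall>p\<in>P. w (False, p) = D1 (\<lambda>q. t (False, q)) (\<lambda>q. t (True, q)) p)"
  proof
    assume "\<exists>g h. \<forall>p\<in>P. w (False, p) = D1 g h p"
    then obtain g h where "\<forall>p\<in>P. w (False, p) = D1 g h p" by blast
    thus "\<exists>t. \<forall>p\<in>P. w (False, p) = D1 (\<lambda>q. t (False, q)) (\<lambda>q. t (True, q)) p"
      by (intro exI[of _ "\<lambda>y. if fst y then h (snd y) else g (snd y)"]) simp
  qed blast
  also have "\<dots> \<longleftrightarrow> (\<exists>t. \<forall>y\<in>cells 0. w y = (\<Sum>z\<in>cells (Suc 0). diff 0 y z * t z))"
    by (auto simp: cells_def[of 0] sum_cells diff_def D1_def)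
  finally show ?thesis .
qed

lemma exact_cells1:
  fixes w :: "bool \<times> 'v \<times> 'v \<Rightarrow> ('v, 'k::field) poly_ring"
  shows "(\<forall>x\<in>cells 0. (\<Sum>y\<in>cells (Suc 0). diff 0 x y * w y) = 0) \<longleftrightarrow>
    (\<exists>t. \<forall>y\<in>cells (Suc 0). w y = (\<Sum>z\<in>cells (Suc (Suc 0)). diff (Suc 0) y z * t z))"
proof -
  let ?R = "\<lambda>t. (\<forall>p\<in>PB. w (False, p) = (\<Sum>q\<in>PAB. KA p q * t q)) \<and>
      (\<forall>p\<in>PA. w (True, p) = - (\<Sum>q\<in>PAB. KB p q * t q))"
  have "(\<forall>x\<in>cells 0. (\<Sum>y\<in>cells (Suc 0). diff 0 x y * w y) = 0) \<longleftrightarrow>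
      (\<forall>p\<in>P. D1 (\<lambda>q. w (False, q)) (\<lambda>q. w (True, q)) p = 0)"
    by (auto simp: cells_def[of 0] sum_cells diff_def D1_def)
  also have "\<dots> \<longleftrightarrow> (\<exists>t. ?R t)" by (rule exact_D1)
  also have "\<dots> \<longleftrightarrow> (\<exists>t. ?R (\<lambda>q. t (False, q)))"
  proof
    assume "\<exists>t. ?R t"
    then obtain t where "?R t" by blast
    thus "\<exists>t. ?R (\<lambda>q. t (False, q))" by (intro exI[of _ "\<lambda>y. t (snd y)"]) simp
  next
    assume "\<exists>t. ?R (\<lambda>q. t (False, q))"
    then obtain t where "?R (\<lambda>q. t (False, q))" by blast
    thus "\<exists>t. ?R t" by (rule exI[of _ "\<lambda>q. t (False, q)"])
  qed
  also have "\<dots> \<longleftrightarrow> (\<exists>t. \<forall>y\<in>cells (Suc 0). w y = (\<Sum>z\<in>cells (Suc (Suc 0)). diff (Suc 0) y z * t z))"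
    by (simp add: cells_def[of "Suc 0"] ball_Un sum_cells diff_def sum_negf)
  finally show ?thesis .
qed

text \<open>Injectivity of the last map: in the untagged row of an edge \<open>p\<close> of
  \<open>PAB\<close> it is multiplication by \<open>Var (fst p)\<close>.\<close>

lemma exact_cells2:
  fixes w :: "bool \<times> 'v \<times> 'v \<Rightarrow> ('v, 'k::field) poly_ring"
  shows "(\<forall>x\<in>cells (Suc 0). (\<Sum>y\<in>cells (Suc (Suc 0)). diff (Suc 0) x y * w y) = 0) \<longleftrightarrow>
    (\<forall>y\<in>cells (Suc (Suc 0)). w y = 0)"
proof
  assume L: "\<forall>x\<in>cells (Suc 0). (\<Sum>y\<in>cells (Suc (Suc 0)). diff (Suc 0) x y * w y) = 0"
  have "w (False, p) = 0" if p: "p \<in> PAB" for p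
  proof (rule Var_mult_eq_0)
    have "(False, p) \<in> cells (Suc 0)" "fst p \<noteq> a0" using p by (auto simp: cells_def PAB_def PB_def)
    thus "Var (fst p) * w (False, p) = 0"
      using bspec[OF L, of "(False, p)"] p by (simp add: sum_cells diff_def sum_KA_in_A)
  qed
  thus "\<forall>y\<in>cells (Suc (Suc 0)). w y = 0" by (auto simp: cells_def)
qed simp

lemma KA_KB_linear:
  "homogeneous 1 (KA p q)" "homogeneous 1 (KB p q)"
  "KA p q \<in> irrelevant_ideal" "KB p q \<in> irrelevant_ideal" "- KB p q \<in> irrelevant_ideal"
  by (simp_all add: KA_def KB_def homogeneous_Var Var_in_irrelevant_ideal)

lemma minimal_resolution:
  assumes J: "(J :: ('v, 'k::field) poly_ring set) = ideal_gen (gen ` P)"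
  shows "\<exists>s d. minimal_graded_free_resolution J (\<lambda>i. card (cells i)) s d"
proof -
  \<comment> \<open>The resolution is linear: each generator omits two of the variables, and every
    differential raises degrees by one. Shifts are integers, so the subtraction is not
    truncated.\<close>
  let ?s = "\<lambda>i. int (card (UNIV :: 'v set)) - 2 + int i"
  have "\<exists>d. minimal_graded_free_resolution J (\<lambda>i. card (cells i)) (\<lambda>i _. ?s i) d"
  proof (rule minimal_resolution_of_indexed_complex)
    show "finite (cells i)" for i by (rule finite)
    have "J = range (\<lambda>w. \<Sum>p\<in>P. gen p * w p)" unfolding J by (rule ideal_gen_image) simp
    also have "\<dots> = range (\<lambda>w. \<Sum>y\<in>cells 0. gen (snd y) * w y)"
    proof (intro equalityI subsetI)
      fix x assume "x \<in> range (\<lambda>w. \<Sum>p\<in>P. gen p * w p)"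
      then obtain w where "x = (\<Sum>p\<in>P. gen p * w p)" by blast
      thus "x \<in> range (\<lambda>w. \<Sum>y\<in>cells 0. gen (snd y) * w y)"
        by (intro range_eqI[where x = "\<lambda>y. w (snd y)"]) (simp add: sum_cells)
    next
      fix x assume "x \<in> range (\<lambda>w. \<Sum>y\<in>cells 0. gen (snd y) * w y)"
      then obtain w where "x = (\<Sum>y\<in>cells 0. gen (snd y) * w y)" by blast
      thus "x \<in> range (\<lambda>w. \<Sum>p\<in>P. gen p * w p)"
        by (intro range_eqI[where x = "\<lambda>p. w (False, p)"]) (simp add: sum_cells)
    qed
    finally show "J = range (\<lambda>w. \<Sum>y\<in>cells 0. gen (snd y) * w y)" .
    show "(\<Sum>y\<in>cells 0. gen (snd y) * w y) = 0 \<longleftrightarrow>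
        (\<exists>t. \<forall>y\<in>cells 0. w y = (\<Sum>z\<in>cells (Suc 0). diff 0 y z * t z))"
      for w :: "_ \<Rightarrow> ('v, 'k) poly_ring" by (rule exact_cells0)
    show "(\<forall>x\<in>cells i. (\<Sum>y\<in>cells (Suc i). diff i x y * w y) = 0) \<longleftrightarrow>
        (\<exists>t. \<forall>y\<in>cells (Suc i). w y = (\<Sum>z\<in>cells (Suc (Suc i)). diff (Suc i) y z * t z))"
      for i and w :: "_ \<Rightarrow> ('v, 'k) poly_ring"
    proof -
      \<comment> \<open>At \<open>i = 1\<close> the following index set is empty and the claim is
        injectivity; beyond that there are no cells in degree \<open>Suc i\<close>.\<close>
      consider "i = 0" | "i = 1" | "i > 1" by linarith
      thus ?thesis
      proof cases
        case 1
        show ?thesis unfolding 1 by (rule exact_cells1)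
      next
        case 2
        have "cells (Suc (Suc 1)) = {}" by (simp add: cells_def)
        thus ?thesis unfolding 2 using exact_cells2[of w] by simp
      next
        case 3
        hence "cells (Suc i) = {}" by (simp add: cells_def)
        thus ?thesis by simp
      qed
    qed
    show "homogeneous (?s 0) (gen (snd y))" if "y \<in> cells 0" for y
    proof -
      have "snd y \<in> P" using that by (auto simp: cells_def)
      hence "fst (snd y) \<noteq> snd (snd y)" using P_neq by (cases "snd y") auto
      hence c: "card {fst (snd y), snd (snd y)} = 2" by simp
      have "int (card (- {fst (snd y), snd (snd y)})) = ?s 0"
        using card_mono[of UNIV "{fst (snd y), snd (snd y)}"] c
        by (simp add: Compl_eq_Diff_UNIV card_Diff_subset)
      thus ?thesis unfolding gen_def by (metis homogeneous_prod_Var)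
    qed
    show "homogeneous (?s (Suc i) - ?s i) (diff i x y)" for i x y
      by (simp add: diff_def KA_KB_linear)
    show "diff i x y \<in> irrelevant_ideal" for i x y
      by (simp add: diff_def KA_KB_linear)
  qed
  thus ?thesis by blast
qed

text \<open>The omitted stars have \<open>card A\<close> and \<open>card B\<close> edges and share
  only \<open>(a0, b0)\<close>, which accounts for the extra one in the third count.\<close>

lemma card_edges:
  "card PB + card A = card P" "card PA + card B = card P" "card PAB + card A + card B = card P + 1"
proof -
  let ?A = "(\<lambda>a. (a, b0)) ` A" and ?B = "(\<lambda>b. (a0, b)) ` B"
  have AB: "card ?A = card A" "card ?B = card B" by (auto intro!: card_image inj_onI)
  have sub': "?A \<subseteq> P" "?B \<subseteq> P" using a0 b0 by auto
  have eq: "PB = P - ?A" "PA = P - ?B" "PAB = P - (?A \<union> ?B)"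
    using sub by (auto simp: PA_def PB_def PAB_def)
  have "?A \<inter> ?B = {(a0, b0)}" using a0 b0 by auto
  hence "card (?A \<union> ?B) + 1 = card A + card B"
    using card_Un_Int[of ?A ?B] AB by simp
  moreover have compl: "card (P - Q) + card Q = card P" if "Q \<subseteq> P" for Q
    using card_mono[OF finite that] by (simp add: card_Diff_subset that)
  ultimately show "card PB + card A = card P" "card PA + card B = card P"
      "card PAB + card A + card B = card P + 1"
    using AB compl[OF sub'(1)] compl[OF sub'(2)] compl[OF Un_least[OF sub']] unfolding eq by linarith+
qed

lemma card_cells:
  "card (cells 0) = card P" "card (cells 1) = card PA + card PB" "card (cells 2) = card PAB"
proof -
  have "card ({False} \<times> PB \<union> {True} \<times> PA) = card ({False} \<times> PB) + card ({True} \<times> PA)"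
    by (intro card_Un_disjoint) auto
  thus "card (cells 1) = card PA + card PB" by (simp add: cells_def card_cartesian_product)
qed (simp_all add: cells_def card_cartesian_product)

end

section \<open>Unmixed chordal graphs of independence dimension one\<close>

lemma independent_extends:
  fixes E :: "'v::finite set set"
  assumes "independent E F"
  obtains M where "maximal_independent E M" "F \<subseteq> M"
proof -
  obtain M where M: "independent E M" "F \<subseteq> M"
    and max: "\<And>N. independent E N \<Longrightarrow> F \<subseteq> N \<Longrightarrow> card N \<le> card M"
    using ex_has_greatest_nat[of "\<lambda>M. independent E M \<and> F \<subseteq> M" F card "Suc (card (UNIV :: 'v set))"]
      assms by (metis card_mono finite_class.finite_UNIV less_Suc_eq_le subset_UNIV order_refl)
  have "maximal_independent E M"
    unfolding maximal_independent_def
  proof (intro conjI allI impI notI)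
    fix B assume "M \<subset> B" "independent E B"
    with max[of B] M(2) psubset_card_mono[of B M] show False by auto
  qed (rule M(1))
  with M(2) that show thesis by blast
qed

lemma vertex_cover_iff_independent: "vertex_cover E C \<longleftrightarrow> independent E (- C)"
  unfolding vertex_cover_def independent_def by blast

lemma minimal_vertex_cover_iff: "minimal_vertex_cover E C \<longleftrightarrow> maximal_independent E (- C)"
proof -
  have "(\<forall>D. D \<subset> C \<longrightarrow> \<not> independent E (- D)) \<longleftrightarrow> (\<forall>B. - C \<subset> B \<longrightarrow> \<not> independent E B)"
    by (metis compl_less_swap1 double_complement compl_less_swap2)
  thus ?thesis
    unfolding minimal_vertex_cover_def maximal_independent_def vertex_cover_iff_independent by simp
qed

text \<open>The dimension is attained by a face with two vertices, and the maximal independent set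
  containing it has no more. Unmixedness, read on complements, gives all maximal independent sets
  this size.\<close>

lemma card_maximal_independent:
  fixes E :: "'v::finite set set"
  assumes um: "unmixed E" and dim: "complex_dim (independence_complex E) = 1"
    and M: "maximal_independent E M"
  shows "card M = 2"
proof -
  let ?X = "(\<lambda>F. int (card F) - 1) ` independence_complex E"
  have X: "Max ?X = 1" using dim by (simp add: complex_dim_def)
  have fin: "finite ?X" by simp
  have mem: "M \<in> independence_complex E" using M by (auto simp: independence_complex_def)
  hence "1 \<in> ?X" using Max_in[OF fin] X by auto
  then obtain F where F: "F \<in> independence_complex E" "card F = 2" by auto
  then obtain N where N: "maximal_independent E N" "F \<subseteq> N" by (auto simp: independence_complex_def)
  have "N \<in> independence_complex E" using N by (auto simp: independence_complex_def)
  hence "int (card N) - 1 \<le> 1" using Max_ge[OF fin, of "int (card N) - 1"] X by auto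
  moreover have "card F \<le> card N" using N(2) by (simp add: card_mono)
  ultimately have cN: "card N = 2" using F(2) by simp
  have "card (- N) = card (- M)"
    using um N(1) M unfolding unmixed_def minimal_vertex_cover_iff by (metis double_complement)
  thus ?thesis using cN card_mono[of UNIV N] card_mono[of UNIV M] 
    by (simp add: Compl_eq_Diff_UNIV card_Diff_subset)
qed

text \<open>Distinctness of opposite vertices is a separate hypothesis: for \<open>a = c\<close> the
  set \<open>{a, c}\<close> is a singleton, which is never an edge.\<close>

lemma chordal_no_C4:
  assumes E: "simple_graph E" and ch: "chordal E"
    and e: "{a, b} \<in> E" "{b, c} \<in> E" "{c, d} \<in> E" "{d, a} \<in> E"
    and n: "{a, c} \<notin> E" "{b, d} \<notin> E" and dist: "a \<noteq> c" "b \<noteq> d"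
  shows False
proof -
  have loop: "{x} \<notin> E" for x using E by (auto simp: simple_graph_def)
  have sw: "{x, y} \<in> E \<Longrightarrow> {y, x} \<in> E" and sw': "{x, y} \<notin> E \<Longrightarrow> {y, x} \<notin> E" for x y
    by (simp_all add: insert_commute)
  have *: "a \<noteq> b" "b \<noteq> c" "c \<noteq> d" "d \<noteq> a" using e loop by auto
  have "induced_cycle E [a, b, c, d]"
    unfolding induced_cycle_def
  proof (intro conjI allI impI)
    show "distinct [a, b, c, d]" using * dist by auto
    fix i j assume "i < length [a, b, c, d]" "j < length [a, b, c, d]"
    hence "i \<in> {0, 1, 2, 3}" "j \<in> {0, 1, 2, 3}" by auto
    thus "{[a, b, c, d] ! i, [a, b, c, d] ! j} \<in> E \<longleftrightarrow>
        j = Suc i mod length [a, b, c, d] \<or> i = Suc j mod length [a, b, c, d]"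
      by (elim insertE emptyE) (simp_all add: e n loop e[THEN sw] n[THEN sw'])
  qed simp
  thus False using ch unfolding chordal_def by fastforce
qed

lemma chordal_no_C5:
  assumes E: "simple_graph E" and ch: "chordal E"
    and e: "{a, b} \<in> E" "{b, c} \<in> E" "{c, d} \<in> E" "{d, e} \<in> E" "{e, a} \<in> E"
    and n: "{a, c} \<notin> E" "{a, d} \<notin> E" "{b, d} \<notin> E" "{b, e} \<notin> E" "{c, e} \<notin> E"
  shows False
proof -
  have loop: "{x} \<notin> E" for x using E by (auto simp: simple_graph_def)
  have sw: "{x, y} \<in> E \<Longrightarrow> {y, x} \<in> E" and sw': "{x, y} \<notin> E \<Longrightarrow> {y, x} \<notin> E" for x y
    by (simp_all add: insert_commute)
  have *: "a \<noteq> b" "b \<noteq> c" "c \<noteq> d" "d \<noteq> e" "e \<noteq> a" using e loop by auto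
  \<comment> \<open>Identifying two nonadjacent vertices would turn an edge of the cycle into one of
    the excluded chords.\<close>
  have **: "a \<noteq> c" "a \<noteq> d" "b \<noteq> d" "b \<noteq> e" "c \<noteq> e"
    using e[THEN sw] e n by auto
  have "induced_cycle E [a, b, c, d, e]"
    unfolding induced_cycle_def
  proof (intro conjI allI impI)
    show "distinct [a, b, c, d, e]" using * ** by auto
    fix i j assume "i < length [a, b, c, d, e]" "j < length [a, b, c, d, e]"
    hence "i \<in> {0, 1, 2, 3, 4}" "j \<in> {0, 1, 2, 3, 4}" by auto
    thus "{[a, b, c, d, e] ! i, [a, b, c, d, e] ! j} \<in> E \<longleftrightarrow>
        j = Suc i mod length [a, b, c, d, e] \<or> i = Suc j mod length [a, b, c, d, e]"
      by (elim insertE emptyE) (simp_all add: e n loop e[THEN sw] n[THEN sw'])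
  qed simp
  thus False using ch unfolding chordal_def by fastforce
qed

text \<open>
  In the complement graph \<open>H\<close>, the edge \<open>ab\<close> maximising the union of the neighbourhoods of its ends
  reaches every vertex: a missed vertex would give a better edge, an induced \<open>2K\<^sub>2\<close> or a 5-cycle,
  and the complements of the last two are induced cycles.
\<close>

lemma unmixed_chordal_bipartition:
  fixes E :: "'v::finite set set"
  assumes E: "simple_graph E" and um: "unmixed E" and ch: "chordal E"
    and dim: "complex_dim (independence_complex E) = 1"
  obtains A B a0 b0 where "A \<inter> B = {}" "A \<union> B = UNIV" "a0 \<in> A" "b0 \<in> B"
    "\<forall>b\<in>B. {a0, b} \<notin> E" "\<forall>a\<in>A. {a, b0} \<notin> E"
    "{C. minimal_vertex_cover E C} = {- {a, b} | a b. a \<in> A \<and> b \<in> B \<and> {a, b} \<notin> E}"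
proof -
  define H where "H x y \<longleftrightarrow> x \<noteq> y \<and> {x, y} \<notin> E" for x y
  have sym: "H x y \<Longrightarrow> H y x" for x y by (auto simp: H_def insert_commute)
  have irr: "\<not> H x x" for x by (simp add: H_def)
  have EH: "{x, y} \<in> E" if "\<not> H x y" "x \<noteq> y" for x y using that by (simp add: H_def)
  have c2: "card M = 2" if "maximal_independent E M" for M
    by (rule card_maximal_independent[OF um dim that])
  have indep_card: "card F \<le> 2" if "independent E F" for F
    using independent_extends[OF that] c2 by (metis card_mono finite)
  have H_indep: "independent E {x, y}" if "H x y" for x y
    using that E unfolding independent_def H_def simple_graph_def
    by (metis card_2_iff card_seteq finite.intros insert_iff card_insert_disjoint eq_iff)
  have H_tri: False if "H x y" "H y z" "H z x" for x y z
  proof -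
    have "independent E {x, y, z}"
      unfolding independent_def
    proof (intro ballI notI)
      fix e assume e: "e \<in> E" "e \<subseteq> {x, y, z}"
      then obtain u v where "e = {u, v}" "u \<noteq> v" using E by (auto simp: simple_graph_def card_2_iff)
      with e that show False by (auto simp: H_def insert_commute)
    qed
    from indep_card[OF this] that show False by (auto simp: H_def)
  qed
  have H_maximal: "maximal_independent E M \<longleftrightarrow> (\<exists>x y. M = {x, y} \<and> H x y)" for M
  proof
    assume M: "maximal_independent E M"
    from c2[OF this] obtain x y where "M = {x, y}" "x \<noteq> y" by (auto simp: card_2_iff)
    thus "\<exists>x y. M = {x, y} \<and> H x y" using M by (auto simp: H_def maximal_independent_def independent_def)
  next
    assume "\<exists>x y. M = {x, y} \<and> H x y"
    then obtain x y where M: "M = {x, y}" "H x y" by blast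
    obtain N where N: "maximal_independent E N" "M \<subseteq> N"
      using independent_extends[OF H_indep[OF M(2)]] M(1) by blast
    have "M = N" using c2[OF N(1)] N(2) M by (intro card_seteq) (auto simp: H_def)
    thus "maximal_independent E M" using N(1) by simp
  qed
  \<comment> \<open>Every vertex lies in a maximal independent set, which is an edge of
    \<open>H\<close>; hence \<open>H\<close> has no isolated vertices.\<close>
  have H_ex: "\<exists>y. H x y" for x
  proof -
    have "independent E {x}" using E by (auto simp: independent_def simple_graph_def subset_singleton_iff)
    then obtain M where "maximal_independent E M" "x \<in> M" using independent_extends by (metis insert_subset)
    thus ?thesis using sym by (auto simp: H_maximal)
  qed
  \<comment> \<open>In the original graph \<open>a, c, b, d\<close> is a cycle whose two chords
    \<open>ab\<close> and \<open>cd\<close> are missing.\<close>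
  have no_2K2: False if "H a b" "H c d" "\<not> H a c" "\<not> H a d" "\<not> H b c" "\<not> H b d"
    "a \<noteq> c" "a \<noteq> d" "b \<noteq> c" "b \<noteq> d" for a b c d
    by (rule chordal_no_C4[OF E ch, of a c b d])
      (use that in \<open>auto intro: EH simp: H_def insert_commute\<close>)
  define N where "N x = {y. H x y}" for x
  obtain p where p: "H (fst p) (snd p)" and
    max: "\<And>q. H (fst q) (snd q) \<Longrightarrow> card (N (fst q) \<union> N (snd q)) \<le> card (N (fst p) \<union> N (snd p))"
  proof -
    \<comment> \<open>Types are nonempty, so \<open>undefined\<close> is a vertex and some edge of
      \<open>H\<close> exists to start the maximisation.\<close>
    obtain y where "H undefined y" using H_ex by blast
    thus thesis
      using ex_has_greatest_nat[of "\<lambda>p. H (fst p) (snd p)" "(undefined, y)"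
          "\<lambda>p. card (N (fst p) \<union> N (snd p))" "Suc (card (UNIV :: 'v set))"] that
      by (metis card_mono finite_class.finite_UNIV less_Suc_eq_le subset_UNIV fst_conv snd_conv)
  qed
  define a b where "a = fst p" and "b = snd p"
  have ab: "H a b" and max: "\<And>x y. H x y \<Longrightarrow> card (N x \<union> N y) \<le> card (N a \<union> N b)"
    using p max[of "(x, y)" for x y] by (auto simp: a_def b_def)
  \<comment> \<open>If \<open>c\<close> is missed by the optimal edge \<open>uv\<close> and has a
    neighbour \<open>d\<close> adjacent to \<open>u\<close>, then \<open>ud\<close> is strictly
    better: \<open>N v\<close> is contained in \<open>N d\<close>, and \<open>c\<close> is
    gained.\<close>
  have step: False if uv: "H u v" and m: "\<And>x y. H x y \<Longrightarrow> card (N x \<union> N y) \<le> card (N u \<union> N v)"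
    and c: "\<not> H u c" "\<not> H v c" and cd: "H c d" and du: "H u d" for u v c d
  proof -
    have dv: "\<not> H v d" using H_tri[of u v d] uv du sym by blast
    have "N v \<subseteq> N d"
    proof
      fix w assume "w \<in> N v"
      hence vw: "H v w" by (simp add: N_def)
      show "w \<in> N d"
      proof (rule ccontr)
        assume "w \<notin> N d"
        hence dw: "\<not> H d w" by (simp add: N_def)
        \<comment> \<open>Otherwise the edges \<open>vw\<close> and \<open>cd\<close> form an
          induced pair of disjoint edges in \<open>H\<close>.\<close>
        have cw: "H c w"
        proof (rule ccontr)
          assume "\<not> H c w"
          thus False
            using no_2K2[OF vw cd] c dv dw cd vw uv sym by blast
        qed
        have uw: "\<not> H u w" using H_tri[of u v w] uv vw sym by blast
        have ne: "u \<noteq> w" "w \<noteq> d" "d \<noteq> v" "v \<noteq> c" "c \<noteq> u"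
          using uv vw cw cd du c dv dw uw sym by blast+
        \<comment> \<open>In \<open>H\<close> the vertices \<open>u, v, w, c, d\<close> form an
          induced 5-cycle; its complement is again a 5-cycle, in the order
          \<open>u, w, d, v, c\<close>.\<close>
        show False
          by (rule chordal_no_C5[OF E ch, of u w d v c])
            (use ne uw dw dv c uv vw cw cd du in \<open>auto intro: EH simp: H_def insert_commute\<close>)
      qed
    qed
    moreover have "c \<in> N d" "c \<notin> N u \<union> N v" using cd c sym by (auto simp: N_def)
    ultimately have "N u \<union> N v \<subset> N u \<union> N d" by blast
    hence "card (N u \<union> N v) < card (N u \<union> N d)" by (intro psubset_card_mono) auto
    with m[OF du] show False by simp
  qed
  have dom: "N a \<union> N b = UNIV"
  proof (rule ccontr)
    assume "N a \<union> N b \<noteq> UNIV"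
    then obtain c where c: "\<not> H a c" "\<not> H b c" by (auto simp: N_def)
    obtain d where cd: "H c d" using H_ex by blast
    \<comment> \<open>If \<open>d\<close> were adjacent to neither end, \<open>ab\<close> and
      \<open>cd\<close> would be induced disjoint edges. The two cases differ only by exchanging
      \<open>a\<close> and \<open>b\<close>.\<close>
    have "H a d \<or> H b d"
      using no_2K2[OF ab cd] c ab cd sym by blast
    moreover have "card (N x \<union> N y) \<le> card (N b \<union> N a)" if "H x y" for x y
      using max[OF that] by (simp add: Un_commute)
    ultimately show False
      using step[OF ab max c cd] step[OF sym[OF ab] _ c(2,1) cd] by blast
  qed
  have NN: "N x \<inter> N y = {}" if "H x y" for x y using H_tri that sym unfolding N_def by blast
  have N_indep: "\<not> H x y" if "x \<in> N z" "y \<in> N z" for x y z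
    using that H_tri sym unfolding N_def by blast
  show thesis
  \<comment> \<open>The part containing \<open>a\<close> is \<open>N b\<close>, so that
    \<open>a\<close> is joined in \<open>H\<close> to the whole opposite part \<open>N a\<close>,
    and likewise for \<open>b\<close>.\<close>
  proof (rule that[of "N b" "N a" a b])
    show "N b \<inter> N a = {}" "N b \<union> N a = UNIV" using NN[OF ab] dom by auto
    show "a \<in> N b" "b \<in> N a" using ab sym by (auto simp: N_def)
    show "\<forall>y\<in>N a. {a, y} \<notin> E" by (auto simp: N_def H_def)
    show "\<forall>x\<in>N b. {x, b} \<notin> E" by (auto simp: N_def H_def insert_commute)
    have HE: "H x y \<longleftrightarrow> {x, y} \<notin> E" if "x \<in> N b" "y \<in> N a" for x y
      using that NN[OF ab] by (auto simp: H_def)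
    have "minimal_vertex_cover E C \<longleftrightarrow> (\<exists>x y. - C = {x, y} \<and> x \<in> N b \<and> y \<in> N a \<and> H x y)" for C
    proof -
      have "(\<exists>x y. - C = {x, y} \<and> x \<in> N b \<and> y \<in> N a \<and> H x y)" if "- C = {x, y}" "H x y" for x y
      proof (cases "x \<in> N b")
        case True
        hence "y \<in> N a" using that N_indep dom by blast
        with True that show ?thesis by blast
      next
        case False
        hence "x \<in> N a" using dom by blast
        moreover have "y \<in> N b" using calculation that N_indep dom by blast
        moreover have "- C = {y, x}" using that by blast
        ultimately show ?thesis using that sym by blast
      qed
      thus ?thesis unfolding minimal_vertex_cover_iff H_maximal by blast
    qed
    hence "minimal_vertex_cover E C \<longleftrightarrow>
        (\<exists>x y. C = - {x, y} \<and> x \<in> N b \<and> y \<in> N a \<and> {x, y} \<notin> E)" for C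
      using HE by (metis double_complement)
    thus "{C. minimal_vertex_cover E C} =
        {- {x, y} | x y. x \<in> N b \<and> y \<in> N a \<and> {x, y} \<notin> E}" by simp
  qed
qed

theorem proposition4p10:
  fixes E :: "'v::finite set set" and n :: nat and J :: "('v, 'k::field) poly_ring set"
  assumes "simple_graph E"
    and "card (UNIV :: 'v set) = n"
    and "unmixed E"
    and "chordal E"
    and "complex_dim (independence_complex E) = 1"
    and "J = cover_ideal E"
  shows "int (betti 1 J) = 2 * int (betti 0 J) - int n
       \<and> int (betti 2 J) = int (betti 0 J) - int n + 1"
proof -
  obtain A B a0 b0 where AB: "A \<inter> B = {}" "A \<union> B = UNIV" "a0 \<in> A" "b0 \<in> B"
      "\<forall>b\<in>B. {a0, b} \<notin> E" "\<forall>a\<in>A. {a, b0} \<notin> E"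
    and mvc: "{C. minimal_vertex_cover E C} = {- {a, b} | a b. a \<in> A \<and> b \<in> B \<and> {a, b} \<notin> E}"
    by (rule unmixed_chordal_bipartition[OF assms(1,3,4,5)])
  define P where "P = {p \<in> A \<times> B. {fst p, snd p} \<notin> E}"
  interpret spanned_bipartite A B P a0 b0
    by unfold_locales (use AB in \<open>auto simp: P_def\<close>)
  have "{(\<Prod>v\<in>C. Var v :: ('v, 'k) poly_ring) | C. minimal_vertex_cover E C} =
      (\<lambda>C. \<Prod>v\<in>C. Var v) ` {C. minimal_vertex_cover E C}" by blast
  also have "{C. minimal_vertex_cover E C} = (\<lambda>p. - {fst p, snd p}) ` P"
    unfolding mvc P_def by (auto simp: image_Collect)
  also have "(\<lambda>C. \<Prod>v\<in>C. Var v :: ('v, 'k) poly_ring) ` \<dots> = gen ` P"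
    by (simp add: image_image gen_def)
  finally have "J = ideal_gen (gen ` P)" using assms(6) by (simp add: cover_ideal_def)
  then obtain s d where "minimal_graded_free_resolution J (\<lambda>i. card (cells i)) s d"
    using minimal_resolution by blast
  note betti = betti_eqI[OF this]
  \<comment> \<open>The two parts partition the vertices, so the star sizes removed in the edge
    counts add up to \<open>n\<close>.\<close>
  have "card A + card B = n" using card_Un_disjoint[of A B] AB assms(2) by simp
  thus ?thesis using card_edges unfolding betti card_cells by linarith
qed

end
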